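(* Let $\Phi=\{\phi_n:n\in\mathbb N\}$ be an infinite autonomous conformal iterated function system on $X$. Let $\sigma:\mathbb N^{\mathbb N}\to\mathbb N^{\mathbb N}$ be the shift, $\sigma(\omega)_n=\omega_{n+1}$, and let \[I^\infty_{\mathrm{dense}}=\{\omega\in\mathbb N^{\mathbb N}:\{\sigma^n(\omega):n\ge0\}\text{ is dense in }\mathbb N^{\mathbb N}\},\] where $\mathbb N^{\mathbb N}$ carries the product topology. Set $J_{\mathrm{dense}}(\Phi)=\pi_\Phi(I^\infty_{\mathrm{dense}})$. Then \[\operatorname{HD}(J_{\mathrm{dense}}(\Phi))=\operatorname{HD}(J(\Phi)).\]
   Context: Fix $d\in\mathbb N$ and a compact set $X\subset\mathbb R^d$ equal to the closure of its interior, with $\partial X$ smooth or $X$ convex. An infinite autonomous conformal iterated function system is a family $\{\phi_n:X\to X\}_{n\in\mathbb N}$ such that: - the sets $\phi_a(\operatorname{int}X)$, $a\in\mathbb N$, are pairwise disjoint; - all $\phi_n$ extend to $C^1$ conformal diffeomorphisms of a common open connected $V\supset X$ into $V$; - there is $K\ge1$ with $|\phi'(x)|\le K|\phi'(y)|$ for $x,y\in V$ and every finite composition $\phi$ of the maps; - $\sup_{x\in X}|\phi_n'(x)|\le\eta<1$ for all $n$. (Equivalently, it is an NCIFS with $I^{(j)}=\mathbb N$ and $\Phi^{(j)}=\Phi$ for all $j$.) For $\omega\in\mathbb N^{\mathbb N}$ put $\phi_{\omega|_n}=\phi_{\omega_1}\circ\cdots\circ\phi_{\omega_n}$. The projection $\pi_\Phi(\omega)$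 is the unique point of $\bigcap_{n\ge1}\phi_{\omega|_n}(X)$. The limit set is $J(\Phi)=\bigcap_n\bigcup_{\omega\in\mathbb N^n}\phi_\omega(X)=\pi_\Phi(\mathbb N^{\mathbb N})$. $\operatorname{HD}$ is Hausdorff dimension. *)

theory Defs
  imports "HOL-Analysis.Analysis"
begin

coinductive smooth_fun :: "'a::euclidean_space set \<Rightarrow> ('a \<Rightarrow> real) \<Rightarrow> bool" where
  "(\<forall>x\<in>U. g differentiable (at x)) \<Longrightarrow>
   (\<forall>b\<in>Basis. smooth_fun U (\<lambda>x. frechet_derivative g (at x) b)) \<Longrightarrow> smooth_fun U g"

definition smooth_boundary :: "'a::euclidean_space set \<Rightarrow> bool" where
  "smooth_boundary X \<longleftrightarrow>
     (\<forall>p\<in>frontier X. \<exists>U g. open U \<and> p \<in> U \<and> smooth_fun U g \<and>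
        (\<forall>x\<in>U. frechet_derivative g (at x) \<noteq> (\<lambda>v. 0)) \<and>
        X \<inter> U = {x\<in>U. g x \<le> 0})"

definition hausdorff_content :: "real \<Rightarrow> real \<Rightarrow> 'a::metric_space set \<Rightarrow> ennreal" where
  "hausdorff_content s \<delta> A =
     (INF C \<in> {C :: nat \<Rightarrow> 'a set. A \<subseteq> (\<Union>i. C i) \<and>
                 (\<forall>i. bounded (C i) \<and> diameter (C i) \<le> \<delta>)}.
        (\<Sum>i. ennreal (diameter (C i) powr s)))"

definition hausdorff_measure :: "real \<Rightarrow> 'a::metric_space set \<Rightarrow> ennreal" where
  "hausdorff_measure s A = (SUP \<delta> \<in> {0<..}. hausdorff_content s \<delta> A)"

definition hausdorff_dim :: "'a::metric_space set \<Rightarrow> real" where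
  "hausdorff_dim A = Inf {s. s > 0 \<and> hausdorff_measure s A = 0}"

definition word_comp :: "(nat \<Rightarrow> 'a \<Rightarrow> 'a) \<Rightarrow> nat list \<Rightarrow> 'a \<Rightarrow> 'a" where
  "word_comp \<phi> ws = foldr (\<lambda>w f. \<phi> w \<circ> f) ws id"

definition conformal_linear :: "('a::euclidean_space \<Rightarrow> 'a) \<Rightarrow> bool" where
  "conformal_linear L \<longleftrightarrow> (\<exists>c>0. \<exists>U. orthogonal_transformation U \<and> (\<forall>v. L v = c *\<^sub>R U v))"

definition autonomous_CIFS ::
    "'a::euclidean_space set \<Rightarrow> (nat \<Rightarrow> 'a \<Rightarrow> 'a) \<Rightarrow> bool" where
  "autonomous_CIFS X \<phi> \<longleftrightarrow>
     compact X \<and> X = closure (interior X) \<and> (smooth_boundary X \<or> convex X) \<and>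
     (\<forall>n. \<phi> n ` X \<subseteq> X) \<and>
     (\<forall>a b. a \<noteq> b \<longrightarrow> \<phi> a ` interior X \<inter> \<phi> b ` interior X = {}) \<and>
     (\<exists>V D. open V \<and> connected V \<and> X \<subseteq> V \<and>
        (\<forall>n. \<phi> n ` V \<subseteq> V \<and> inj_on (\<phi> n) V \<and>
             (\<forall>x\<in>V. (\<phi> n has_derivative D n x) (at x) \<and> conformal_linear (D n x)) \<and>
             (\<forall>v. continuous_on V (\<lambda>x. D n x v))) \<and>
        (\<exists>K\<ge>1. \<forall>ws x y L1 L2. x \<in> V \<longrightarrow> y \<in> V \<longrightarrow>
            (word_comp \<phi> ws has_derivative L1) (at x) \<longrightarrow>
            (word_comp \<phi> ws has_derivative L2) (at y) \<longrightarrow> onorm L1 \<le> K * onorm L2) \<and>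
        (\<exists>\<eta><1. \<forall>n. \<forall>x\<in>X. onorm (D n x) \<le> \<eta>))"

definition proj_IFS :: "'a set \<Rightarrow> (nat \<Rightarrow> 'a \<Rightarrow> 'a) \<Rightarrow> (nat \<Rightarrow> nat) \<Rightarrow> 'a" where
  "proj_IFS X \<phi> \<omega> = (THE x. x \<in> (\<Inter>n\<in>{1..}. word_comp \<phi> (map \<omega> [0..<n]) ` X))"

definition limit_set :: "'a set \<Rightarrow> (nat \<Rightarrow> 'a \<Rightarrow> 'a) \<Rightarrow> 'a set" where
  "limit_set X \<phi> = range (proj_IFS X \<phi>)"

definition shift :: "(nat \<Rightarrow> nat) \<Rightarrow> (nat \<Rightarrow> nat)" where
  "shift \<omega> = (\<lambda>k. \<omega> (Suc k))"

text \<open>Words with dense forward shift-orbit in the product topology on nat => nat.\<close>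
definition dense_words :: "(nat \<Rightarrow> nat) set" where
  "dense_words = {\<omega>. closure {(shift ^^ n) \<omega> | n. True} = UNIV}"

definition limit_set_dense :: "'a set \<Rightarrow> (nat \<Rightarrow> 'a \<Rightarrow> 'a) \<Rightarrow> 'a set" where
  "limit_set_dense X \<phi> = proj_IFS X \<phi> ` dense_words"

end

theory Submission
  imports Defs "HOL-Probability.Infinite_Product_Measure" "HOL-Probability.Probability_Mass_Function"
begin

text \<open>Write \<open>a w\<close> for the derivative of \<open>\<phi>\<^sub>w\<close> at a fixed point of the interior, up to the factor \<open>K\<close>. By
  bounded distortion \<open>\<phi>\<^sub>w X\<close> has diameter at most a constant times \<open>a w\<close> and contains a ball of radius
  comparable to \<open>a w\<close>. If the sums of \<open>a w powr t\<close> over words of a given length are bounded uniformly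
  in the length, then the cylinders show that \<open>J\<close> has dimension at most \<open>t\<close>. So for
  \<open>t < HD J\<close> there is a finite set \<open>F\<close> of words of equal length with \<open>\<Sum>w\<in>F. a w powr t \<ge> 2\<close>.

  Concatenate independent random words from \<open>F\<close>, distributed proportionally to \<open>a w powr t\<close>, and insert
  after the \<open>k\<close>-th one a fixed word \<open>u k\<close>, where every finite word occurs among the \<open>u k\<close>: the resulting
  sequences have dense orbits. The gain of a factor \<open>2\<close> per step pays for the insertions if
  they are sparse enough. Cutting each sequence when its ratio first drops to \<open>r\<close>,
  the mass of a cylinder is at most a constant times \<open>r powr (t - d)\<close> times the volume of its inscribed ball;
  these balls are disjoint, so a set of diameter \<open>r\<close> has mass at most a constant times \<open>r powr t\<close>, and the mass
  distribution principle applies.\<close>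

section \<open>Balls in conformal images\<close>

lemma onorm_scaled_orthogonal:
  fixes U :: "'a::euclidean_space \<Rightarrow> 'a"
  assumes U: "orthogonal_transformation U" and c: "0 \<le> c"
  shows "onorm (\<lambda>v. c *\<^sub>R U v) = c"
proof (rule antisym)
  have nU: "norm (U v) = norm v" for v
    using U by (rule orthogonal_transformation_norm)
  show "onorm (\<lambda>v. c *\<^sub>R U v) \<le> c"
    using c by (intro onorm_bound) (auto simp: nU)
  have "linear U"
    using U by (rule orthogonal_transformation_linear)
  then have bl: "bounded_linear (\<lambda>v. c *\<^sub>R U v)"
    by (simp add: linear_conv_bounded_linear[symmetric] linear_compose_scale_right)
  obtain b :: 'a where b: "b \<in> Basis"
    using nonempty_Basis by blast
  show "c \<le> onorm (\<lambda>v. c *\<^sub>R U v)"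
    using onorm[OF bl, of b] b c by (simp add: nU)
qed

text \<open>The inverse has derivative of norm at most \<open>1 / a\<close>, since \<open>f\<close>
  expands every direction by at least \<open>a\<close>. The inverse therefore sends the largest ball
  about \<open>f x0\<close> inside the image, of radius \<open>\<rho>\<close>, into
  \<open>cball x0 (\<rho> / a)\<close>. If \<open>\<rho> < a * r\<close>, this is a compact part of
  the domain, and its image would contain a point limiting \<open>\<rho>\<close>.\<close>

lemma ball_subset_conformal_image:
  fixes f :: "'a::euclidean_space \<Rightarrow> 'a"
  assumes a: "0 < a" and r: "0 < r" and inj: "inj_on f (ball x0 r)"
    and c: "\<And>x. x \<in> ball x0 r \<Longrightarrow> a \<le> c x"
    and U: "\<And>x. x \<in> ball x0 r \<Longrightarrow> orthogonal_transformation (U x)"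
    and der: "\<And>x. x \<in> ball x0 r \<Longrightarrow> (f has_derivative (\<lambda>v. c x *\<^sub>R U x v)) (at x)"
  shows "ball (f x0) (a * r) \<subseteq> f ` ball x0 r"
proof (rule ccontr)
  define B where "B = ball x0 r"
  define g where "g = inv_into B f"
  assume "\<not> ?thesis"
  then obtain y where "y \<in> ball (f x0) (a * r)" "y \<in> - f ` B"
    unfolding B_def by blast
  then have y: "dist (f x0) y < a * r" "y \<in> - f ` B"
    by auto
  have cont: "continuous_on B f"
    unfolding B_def using der by (meson continuous_at_imp_continuous_on has_derivative_continuous)
  have opB: "open B" and x0B: "x0 \<in> B"
    using r by (auto simp: B_def)
  have injB: "inj_on f B"
    using inj by (simp add: B_def)
  have op: "open (f ` B)"
    by (rule invariance_of_domain[OF cont opB injB])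
  have gf: "g (f x) = x" if "x \<in> B" for x
    using that injB by (simp add: g_def)
  have contg: "continuous_on (f ` B) g"
  proof -
    obtain h where h: "homeomorphism B (f ` B) f h"
      using invariance_of_domain_homeomorphism[OF opB cont _ injB] by auto
    have "continuous_on (f ` B) h"
      using h by (simp add: homeomorphism_def)
    moreover have "h z = g z" if "z \<in> f ` B" for z
      using that h gf by (auto simp: homeomorphism_def)
    ultimately show ?thesis
      by (simp cong: continuous_on_cong)
  qed
  define \<rho> where "\<rho> = infdist (f x0) (- f ` B)"
  obtain y' where y': "y' \<in> - f ` B" "\<rho> = dist (f x0) y'"
    using infdist_attains_inf[of "- f ` B" "f x0"] op y(2) unfolding \<rho>_def
    by (metis closed_Compl empty_iff)
  have \<rho>0: "0 < \<rho>"
    using y' x0B by auto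
  have "\<rho> \<le> dist (f x0) y"
    unfolding \<rho>_def by (rule infdist_le[OF y(2)])
  then have \<rho>r: "\<rho> / a < r"
    using y(1) a by (simp add: divide_less_eq mult.commute)
  have sub: "ball (f x0) \<rho> \<subseteq> f ` B"
  proof
    fix z assume z: "z \<in> ball (f x0) \<rho>"
    show "z \<in> f ` B"
    proof (rule ccontr)
      assume "z \<notin> f ` B"
      then have "\<rho> \<le> dist (f x0) z"
        unfolding \<rho>_def by (intro infdist_le) simp
      then show False using z by simp
    qed
  qed
  define g' where "g' z v = (1 / c (g z)) *\<^sub>R inv (U (g z)) v" for z v
  have gB: "g z \<in> B" and fg: "f (g z) = z" if "z \<in> f ` B" for z
    using that gf by auto
  have der_g: "(g has_derivative g' z) (at z)" and on_g: "onorm (g' z) \<le> 1 / a" if z: "z \<in> f ` B" for z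
  proof -
    have x: "g z \<in> ball x0 r"
      using gB[OF z] by (simp add: B_def)
    have cp: "0 < c (g z)"
      using a c[OF x] by simp
    have Ui: "orthogonal_transformation (inv (U (g z)))"
      using U[OF x] by (rule orthogonal_transformation_inv)
    have bl: "bounded_linear (g' z)"
      unfolding g'_def using orthogonal_transformation_linear[OF Ui]
      by (simp add: linear_conv_bounded_linear[symmetric] linear_compose_scale_right)
    have "g' z \<circ> (\<lambda>v. c (g z) *\<^sub>R U (g z) v) = id"
    proof
      fix v
      have "inv (U (g z)) (c (g z) *\<^sub>R U (g z) v) = c (g z) *\<^sub>R inv (U (g z)) (U (g z) v)"
        using orthogonal_transformation_linear[OF Ui] by (simp add: linear_cmul)
      also have "inv (U (g z)) (U (g z) v) = v"
        using orthogonal_transformation_inj[OF U[OF x]] by simp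
      finally show "(g' z \<circ> (\<lambda>v. c (g z) *\<^sub>R U (g z) v)) v = id v"
        using cp by (simp add: g'_def)
    qed
    from has_derivative_inverse_dieudonne[OF opB op cont contg gf gB[OF z] der[OF x] bl this]
    show "(g has_derivative g' z) (at z)"
      using fg[OF z] by simp
    have "onorm (g' z) = 1 / c (g z)"
      unfolding g'_def using cp by (intro onorm_scaled_orthogonal Ui) simp
    also have "\<dots> \<le> 1 / a"
      using c[OF x] a by (simp add: frac_le)
    finally show "onorm (g' z) \<le> 1 / a" .
  qed
  have "ball (f x0) \<rho> \<subseteq> f ` cball x0 (\<rho> / a)"
  proof
    fix z assume z: "z \<in> ball (f x0) \<rho>"
    have "norm (g z - g (f x0)) \<le> 1 / a * norm (z - f x0)"
      by (rule differentiable_bound[where S = "ball (f x0) \<rho>" and f' = g'])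
        (use sub z \<rho>0 in \<open>auto intro!: has_derivative_at_withinI[OF der_g] on_g\<close>)
    also have "\<dots> \<le> \<rho> / a"
      using z a by (simp add: dist_norm norm_minus_commute divide_right_mono)
    finally have "g z \<in> cball x0 (\<rho> / a)"
      using gf[OF x0B] by (simp add: dist_norm norm_minus_commute)
    then show "z \<in> f ` cball x0 (\<rho> / a)"
      using fg[of z] sub z by (metis image_eqI subsetD)
  qed
  moreover have cb: "cball x0 (\<rho> / a) \<subseteq> B"
    using \<rho>r by (auto simp: B_def)
  then have "closed (f ` cball x0 (\<rho> / a))"
    by (intro compact_imp_closed compact_continuous_image continuous_on_subset[OF cont]) auto
  \<comment> \<open>Closedness of the image upgrades the inclusion from the open to the closed ball,
    which contains the nearest outside point \<open>y'\<close>.\<close>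
  ultimately have "cball (f x0) \<rho> \<subseteq> f ` cball x0 (\<rho> / a)"
    using closure_minimal \<rho>0 by (metis closure_ball)
  moreover have "y' \<in> cball (f x0) \<rho>"
    using y'(2) by simp
  ultimately show False
    using y'(1) cb by blast
qed

section \<open>Cylinders of a conformal iterated function system\<close>

lemma word_comp_Nil [simp]: "word_comp \<phi> [] = id"
  by (simp add: word_comp_def)

lemma word_comp_Cons [simp]: "word_comp \<phi> (n # w) = \<phi> n \<circ> word_comp \<phi> w"
  by (simp add: word_comp_def)

lemma word_comp_append: "word_comp \<phi> (u @ v) = word_comp \<phi> u \<circ> word_comp \<phi> v"
  by (induction u) (auto simp: comp_assoc)

text \<open>A ball inside \<open>X\<close> is made part of the data: its centre is the reference point at which the
  contraction ratios of all words are compared.\<close>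

locale cifs =
  fixes X :: "'a::euclidean_space set" and \<phi> :: "nat \<Rightarrow> 'a \<Rightarrow> 'a"
    and V :: "'a set" and D :: "nat \<Rightarrow> 'a \<Rightarrow> 'a \<Rightarrow> 'a" and K \<eta> r0 :: real and x0 :: 'a
  assumes compact_X: "compact X"
    and maps_X: "\<phi> n ` X \<subseteq> X"
    and disjoint_maps: "a \<noteq> b \<Longrightarrow> \<phi> a ` interior X \<inter> \<phi> b ` interior X = {}"
    and open_V: "open V" and connected_V: "connected V" and X_subset_V: "X \<subseteq> V"
    and maps_V: "\<phi> n ` V \<subseteq> V"
    and inj_V: "inj_on (\<phi> n) V"
    and has_derivative_map: "x \<in> V \<Longrightarrow> (\<phi> n has_derivative D n x) (at x)"
    and conformal: "x \<in> V \<Longrightarrow> conformal_linear (D n x)"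
    and K_ge_1: "1 \<le> K"
    and distortion: "\<lbrakk>x \<in> V; y \<in> V; (word_comp \<phi> w has_derivative L1) (at x);
      (word_comp \<phi> w has_derivative L2) (at y)\<rbrakk> \<Longrightarrow> onorm L1 \<le> K * onorm L2"
    and \<eta>_less_1: "\<eta> < 1"
    and contraction: "x \<in> X \<Longrightarrow> onorm (D n x) \<le> \<eta>"
    and r0_pos: "0 < r0" and ball_subset_X: "ball x0 r0 \<subseteq> X"
begin

text \<open>The norm of the derivative of \<open>word_comp \<phi> w\<close> at \<open>x\<close>,
  written as a product along the orbit, so that no derivative of the composition has to be
  chosen.\<close>

fun scale :: "nat list \<Rightarrow> 'a \<Rightarrow> real" where
  "scale [] x = 1"
| "scale (n # w) x = onorm (D n (word_comp \<phi> w x)) * scale w x"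

lemma x0_in_X: "x0 \<in> X" and x0_in_V: "x0 \<in> V"
  using ball_subset_X r0_pos X_subset_V by (auto simp: subset_iff)

lemma word_maps_V: "x \<in> V \<Longrightarrow> word_comp \<phi> w x \<in> V"
  using maps_V by (induction w) (auto simp: image_subset_iff)

lemma word_maps_X: "x \<in> X \<Longrightarrow> word_comp \<phi> w x \<in> X"
  using maps_X by (induction w) (auto simp: image_subset_iff)

lemma inj_on_word: "inj_on (word_comp \<phi> w) V"
proof (induction w)
  case (Cons n w)
  have "inj_on (\<phi> n) (word_comp \<phi> w ` V)"
    by (rule inj_on_subset[OF inj_V]) (use word_maps_V in blast)
  with Cons show ?case
    unfolding word_comp_Cons by (intro comp_inj_on)
qed simp

lemma derivative_map_scaled_orthogonal:
  assumes "x \<in> V"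
  obtains U where "orthogonal_transformation U" "D n x = (\<lambda>v. onorm (D n x) *\<^sub>R U v)"
    "0 < onorm (D n x)"
proof -
  obtain c U where cU: "0 < c" "orthogonal_transformation U" "D n x = (\<lambda>v. c *\<^sub>R U v)"
    using conformal[OF assms, of n] by (auto simp: conformal_linear_def)
  then have "onorm (D n x) = c"
    by (simp add: onorm_scaled_orthogonal)
  with cU that show thesis by simp
qed

text \<open>Scaled orthogonal maps are closed under composition and their factors multiply, so the
  chain rule identifies \<open>scale w x\<close> as the conformal factor.\<close>

lemma word_derivative:
  assumes "x \<in> V"
  shows "0 < scale w x \<and> (\<exists>U. orthogonal_transformation U \<and>
    (word_comp \<phi> w has_derivative (\<lambda>v. scale w x *\<^sub>R U v)) (at x))"
proof (induction w)
  case Nil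
  have "((\<lambda>x. x) has_derivative (\<lambda>v. v)) (at x)"
    by (rule has_derivative_ident)
  then show ?case
    using orthogonal_transformation_id[where 'a='a] by (auto simp: id_def intro!: exI[of _ "\<lambda>v. v"])
next
  case (Cons n w)
  obtain U where U: "orthogonal_transformation U"
    "(word_comp \<phi> w has_derivative (\<lambda>v. scale w x *\<^sub>R U v)) (at x)"
    using Cons by auto
  let ?y = "word_comp \<phi> w x"
  have y: "?y \<in> V"
    using assms by (rule word_maps_V)
  obtain U' where U': "orthogonal_transformation U'" "D n ?y = (\<lambda>v. onorm (D n ?y) *\<^sub>R U' v)"
    "0 < onorm (D n ?y)"
    using derivative_map_scaled_orthogonal[OF y] by blast
  have "(\<phi> n \<circ> word_comp \<phi> w has_derivative D n ?y \<circ> (\<lambda>v. scale w x *\<^sub>R U v)) (at x)"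
    by (rule diff_chain_at[OF U(2) has_derivative_map[OF y]])
  also have "D n ?y \<circ> (\<lambda>v. scale w x *\<^sub>R U v) = (\<lambda>v. scale (n # w) x *\<^sub>R (U' \<circ> U) v)"
    using orthogonal_transformation_linear[OF U'(1)]
    by (subst U'(2)) (auto simp: linear_cmul)
  finally show ?case
    using U U' Cons orthogonal_transformation_compose[OF U'(1) U(1)] by auto
qed

lemma scale_pos: "x \<in> V \<Longrightarrow> 0 < scale w x"
  using word_derivative by blast

lemma scale_append: "scale (u @ v) x = scale u (word_comp \<phi> v x) * scale v x"
  by (induction u) (auto simp: word_comp_append)

lemma scale_distortion:
  assumes "x \<in> V" "y \<in> V"
  shows "scale w x \<le> K * scale w y"
proof -
  obtain U U' where "orthogonal_transformation U" "orthogonal_transformation U'"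
    "(word_comp \<phi> w has_derivative (\<lambda>v. scale w x *\<^sub>R U v)) (at x)"
    "(word_comp \<phi> w has_derivative (\<lambda>v. scale w y *\<^sub>R U' v)) (at y)"
    using word_derivative assms by meson
  then show ?thesis
    using distortion[OF assms] scale_pos[of x w] scale_pos[of y w] assms
    by (metis less_imp_le onorm_scaled_orthogonal)
qed

lemma \<eta>_pos: "0 < \<eta>"
  using contraction[OF x0_in_X, of 0] derivative_map_scaled_orthogonal[OF x0_in_V, of 0]
  by force

lemma scale_le: "x \<in> X \<Longrightarrow> scale w x \<le> \<eta> ^ length w"
proof (induction w)
  case (Cons n w)
  then show ?case
    using contraction[OF word_maps_X[OF Cons.prems], of n] \<eta>_pos scale_pos[of x w] X_subset_V
    by (auto intro!: mult_mono)
qed auto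

text \<open>Dividing by \<open>K\<close> makes the ratio a lower bound for the derivative on all of \<open>V\<close>, hence exactly
  supermultiplicative; the price is the value \<open>1 / K\<close> at the empty word.\<close>

definition ratio :: "nat list \<Rightarrow> real" where
  "ratio w = scale w x0 / K"

lemma ratio_pos: "0 < ratio w"
  using scale_pos[OF x0_in_V] K_ge_1 by (simp add: ratio_def)

lemma ratio_le_scale: "x \<in> V \<Longrightarrow> ratio w \<le> scale w x"
  using scale_distortion[OF x0_in_V, of x w] K_ge_1
  by (simp add: ratio_def divide_le_eq mult.commute)

lemma scale_le_ratio:
  assumes "x \<in> V" shows "scale w x \<le> K\<^sup>2 * ratio w"
  using scale_distortion[OF assms x0_in_V, of w] K_ge_1
  by (simp add: ratio_def power2_eq_square)

lemma ratio_append: "ratio u * ratio v \<le> ratio (u @ v)"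
proof -
  have "ratio u * ratio v \<le> scale u (word_comp \<phi> v x0) * ratio v"
    using ratio_le_scale[of "word_comp \<phi> v x0" u] ratio_pos[of v] word_maps_V[OF x0_in_V, of v]
    by (simp add: mult_right_mono)
  also have "\<dots> = ratio (u @ v)"
    by (simp add: ratio_def scale_append)
  finally show ?thesis .
qed

lemma ratio_le: "ratio w \<le> \<eta> ^ length w"
proof -
  have "ratio w \<le> scale w x0"
    by (rule ratio_le_scale[OF x0_in_V])
  with scale_le[OF x0_in_X, of w] show ?thesis by simp
qed

lemma ratio_le_1: "ratio w \<le> 1"
  using ratio_le[of w] power_le_one[of \<eta> "length w"] \<eta>_pos \<eta>_less_1 by simp

lemma ratio_Nil: "ratio [] = 1 / K"
  by (simp add: ratio_def)

section \<open>Diameters of cylinders\<close>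

lemma continuous_on_word: "continuous_on V (word_comp \<phi> w)"
  using word_derivative by (meson continuous_at_imp_continuous_on has_derivative_continuous)

text \<open>The mean value inequality needs a convex domain, which \<open>V\<close> and
  \<open>X\<close> may fail to be. Balls come first and are chained afterwards.\<close>

lemma word_lipschitz_ball:
  assumes "ball x e \<subseteq> V" "y \<in> ball x e"
  shows "dist (word_comp \<phi> w x) (word_comp \<phi> w y) \<le> K\<^sup>2 * ratio w * dist x y"
proof -
  obtain U where U: "\<And>z. z \<in> V \<Longrightarrow> orthogonal_transformation (U z) \<and>
    (word_comp \<phi> w has_derivative (\<lambda>v. scale w z *\<^sub>R U z v)) (at z)"
    using bchoice[of V "\<lambda>z U. orthogonal_transformation U \<and>
      (word_comp \<phi> w has_derivative (\<lambda>v. scale w z *\<^sub>R U v)) (at z)"] word_derivative by blast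
  have "norm (word_comp \<phi> w x - word_comp \<phi> w y) \<le> K\<^sup>2 * ratio w * norm (x - y)"
  proof (rule differentiable_bound[where S = "ball x e" and f' = "\<lambda>z v. scale w z *\<^sub>R U z v"])
    fix z assume "z \<in> ball x e"
    then have z: "z \<in> V" using assms by auto
    show "(word_comp \<phi> w has_derivative (\<lambda>v. scale w z *\<^sub>R U z v)) (at z within ball x e)"
      using U[OF z] has_derivative_at_withinI by blast
    show "onorm (\<lambda>v. scale w z *\<^sub>R U z v) \<le> K\<^sup>2 * ratio w"
      using U[OF z] scale_pos[OF z, of w] scale_le_ratio[OF z] by (simp add: onorm_scaled_orthogonal)
  qed (use assms le_less_trans[OF zero_le_dist] in auto)
  then show ?thesis by (simp add: dist_norm)
qed

text \<open>Having a bound uniform in \<open>w\<close> is an equivalence relation on points of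
  \<open>V\<close>. Its classes are open by the estimate on balls, so connectedness leaves only
  one.\<close>

lemma word_dist_bound:
  assumes "x \<in> V" "y \<in> V"
  shows "\<exists>M. \<forall>w. dist (word_comp \<phi> w x) (word_comp \<phi> w y) \<le> M * ratio w"
proof (rule connected_equivalence_relation[OF connected_V assms])
  fix x y z
  assume "\<exists>M. \<forall>w. dist (word_comp \<phi> w x) (word_comp \<phi> w y) \<le> M * ratio w"
    and "\<exists>M. \<forall>w. dist (word_comp \<phi> w y) (word_comp \<phi> w z) \<le> M * ratio w"
  then obtain M1 M2 where M: "\<And>w. dist (word_comp \<phi> w x) (word_comp \<phi> w y) \<le> M1 * ratio w"
    "\<And>w. dist (word_comp \<phi> w y) (word_comp \<phi> w z) \<le> M2 * ratio w" by auto
  have "dist (word_comp \<phi> w x) (word_comp \<phi> w z) \<le> (M1 + M2) * ratio w" for w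
    using M(1)[of w] M(2)[of w] dist_triangle[of "word_comp \<phi> w x" "word_comp \<phi> w z" "word_comp \<phi> w y"]
    by (simp add: algebra_simps)
  then show "\<exists>M. \<forall>w. dist (word_comp \<phi> w x) (word_comp \<phi> w z) \<le> M * ratio w" by blast
next
  fix a assume "a \<in> V"
  then obtain e where e: "0 < e" "ball a e \<subseteq> V"
    using open_V open_contains_ball by blast
  have "openin (top_of_set V) (ball a e)"
    using e by (simp add: open_V openin_open_eq)
  moreover have "\<exists>M. \<forall>w. dist (word_comp \<phi> w a) (word_comp \<phi> w x) \<le> M * ratio w"
    if "x \<in> ball a e" for x
    using word_lipschitz_ball[OF e(2) that] by (metis mult.assoc mult.commute)
  ultimately show "\<exists>T. openin (top_of_set V) T \<and> a \<in> T \<and>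
      (\<forall>x\<in>T. \<exists>M. \<forall>w. dist (word_comp \<phi> w a) (word_comp \<phi> w x) \<le> M * ratio w)"
    using e by (meson centre_in_ball)
qed (simp add: dist_commute)

text \<open>Near each point of \<open>X\<close> the distance to the image of \<open>x0\<close> is
  controlled on a small ball. Finitely many such balls cover \<open>X\<close>, which makes the
  constant uniform in the points as well as in the word.\<close>

lemma word_diameter_bound:
  obtains M where "0 < M"
    "\<And>w x y. x \<in> X \<Longrightarrow> y \<in> X \<Longrightarrow> dist (word_comp \<phi> w x) (word_comp \<phi> w y) \<le> M * ratio w"
proof -
  have "\<exists>e M. 0 < e \<and> (\<forall>y \<in> ball x e. \<forall>w. dist (word_comp \<phi> w x0) (word_comp \<phi> w y) \<le> M * ratio w)"
    if x: "x \<in> X" for x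
  proof -
    have xV: "x \<in> V" using x X_subset_V by auto
    then obtain e where e: "0 < e" "ball x e \<subseteq> V"
      using open_V open_contains_ball by blast
    obtain M where M: "\<And>w. dist (word_comp \<phi> w x0) (word_comp \<phi> w x) \<le> M * ratio w"
      using word_dist_bound[OF x0_in_V xV] by auto
    have "dist (word_comp \<phi> w x0) (word_comp \<phi> w y) \<le> (M + K\<^sup>2 * e) * ratio w"
      if y: "y \<in> ball x e" for y w
    proof -
      have "K\<^sup>2 * ratio w * dist x y \<le> K\<^sup>2 * ratio w * e"
        using y ratio_pos[of w] by (intro mult_left_mono) auto
      then show ?thesis
        using M[of w] word_lipschitz_ball[OF e(2) y, of w]
          dist_triangle[of "word_comp \<phi> w x0" "word_comp \<phi> w y" "word_comp \<phi> w x"]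
        by (simp add: algebra_simps)
    qed
    with e show ?thesis by blast
  qed
  then obtain e M where eM: "\<And>x. x \<in> X \<Longrightarrow> 0 < e x"
    "\<And>x y w. x \<in> X \<Longrightarrow> y \<in> ball x (e x) \<Longrightarrow> dist (word_comp \<phi> w x0) (word_comp \<phi> w y) \<le> M x * ratio w"
    by metis
  obtain C where C: "C \<subseteq> X" "finite C" "X \<subseteq> (\<Union>c\<in>C. ball c (e c))"
    using compactE_image[OF compact_X, of X "\<lambda>x. ball x (e x)"] eM(1) by force
  \<comment> \<open>The sum dominates each of the finitely many local constants; the summand
    \<open>1\<close> makes the bound strictly positive.\<close>
  define N where "N = 1 + (\<Sum>c\<in>C. \<bar>M c\<bar>)"
  have N: "dist (word_comp \<phi> w x0) (word_comp \<phi> w y) \<le> N * ratio w" if y: "y \<in> X" for y w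
  proof -
    obtain c where c: "c \<in> C" "y \<in> ball c (e c)"
      using y C(3) by blast
    have "M c \<le> N"
      unfolding N_def using member_le_sum[of c C "\<lambda>c. \<bar>M c\<bar>"] c C(2) by simp
    moreover have "dist (word_comp \<phi> w x0) (word_comp \<phi> w y) \<le> M c * ratio w"
      using eM(2) c C(1) by blast
    ultimately show ?thesis
      using ratio_pos[of w] by (meson less_imp_le mult_right_mono order_trans)
  qed
  show thesis
  proof
    show "0 < 2 * N"
      unfolding N_def by (simp add: add_pos_nonneg sum_nonneg)
    show "dist (word_comp \<phi> w x) (word_comp \<phi> w y) \<le> 2 * N * ratio w" if "x \<in> X" "y \<in> X" for w x y
      using N[OF that(1), of w] N[OF that(2), of w]
        dist_triangle3[of "word_comp \<phi> w x" "word_comp \<phi> w y" "word_comp \<phi> w x0"] by simp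
  qed
qed

section \<open>Disjoint balls inscribed in cylinders\<close>

lemma ball_subset_interior: "ball x0 r0 \<subseteq> interior X"
  using ball_subset_X by (simp add: interior_maximal)

lemma word_maps_interior: "word_comp \<phi> w ` interior X \<subseteq> interior X"
proof (rule interior_maximal)
  have "interior X \<subseteq> V"
    using interior_subset X_subset_V by blast
  then show "open (word_comp \<phi> w ` interior X)"
    using continuous_on_word inj_on_word
    by (intro invariance_of_domain open_interior) (blast intro: continuous_on_subset inj_on_subset)+
  show "word_comp \<phi> w ` interior X \<subseteq> X"
    using word_maps_X interior_subset by blast
qed

text \<open>A common first letter is cancelled by injectivity; distinct first letters separate the
  images by \<open>disjoint_maps\<close>.\<close>

lemma word_images_disjoint:
  assumes "length u = length v" "u \<noteq> v"
  shows "word_comp \<phi> u ` interior X \<inter> word_comp \<phi> v ` interior X = {}"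
  using assms
proof (induction u v rule: list_induct2)
  case (Cons a u b v)
  have sub: "word_comp \<phi> (c # w) ` interior X = \<phi> c ` word_comp \<phi> w ` interior X" for c w
    by (simp add: image_comp)
  show ?case
  proof (cases "a = b")
    case True
    have "word_comp \<phi> w ` interior X \<subseteq> V" for w
      using word_maps_interior interior_subset X_subset_V by blast
    then have "\<phi> a ` word_comp \<phi> u ` interior X \<inter> \<phi> a ` word_comp \<phi> v ` interior X = \<phi> a ` {}"
      using Cons True inj_on_image_Int[OF inj_V[of a]] by (metis list.inject)
    then show ?thesis
      unfolding sub True by simp
  next
    case False
    then show ?thesis
      unfolding sub using disjoint_maps[OF False] word_maps_interior by blast
  qed
qed auto

abbreviation piece :: "nat list \<Rightarrow> 'a set" where
  "piece w \<equiv> ball (word_comp \<phi> w x0) (ratio w * r0)"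

text \<open>\<open>ratio w\<close> bounds the conformal factor from below on all of
  \<open>ball x0 r0\<close>, so the image of that ball contains a concentric one.\<close>

lemma piece_subset: "piece w \<subseteq> word_comp \<phi> w ` interior X"
proof -
  obtain U where U: "\<And>z. z \<in> V \<Longrightarrow> orthogonal_transformation (U z) \<and>
    (word_comp \<phi> w has_derivative (\<lambda>v. scale w z *\<^sub>R U z v)) (at z)"
    using bchoice[of V "\<lambda>z U. orthogonal_transformation U \<and>
      (word_comp \<phi> w has_derivative (\<lambda>v. scale w z *\<^sub>R U v)) (at z)"] word_derivative by blast
  have sub: "ball x0 r0 \<subseteq> V"
    using ball_subset_X X_subset_V by blast
  have "piece w \<subseteq> word_comp \<phi> w ` ball x0 r0"
    by (rule ball_subset_conformal_image[where U = U and c = "scale w"])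
      (use ratio_pos r0_pos inj_on_subset[OF inj_on_word sub] ratio_le_scale U sub in auto)
  with ball_subset_interior show ?thesis by blast
qed

text \<open>The tails \<open>u'\<close> and \<open>v'\<close> are arbitrary, so words of different
  total length can be compared: what matters is a common prefix followed by distinct words of equal
  length.\<close>

lemma pieces_disjoint:
  assumes "length u = length v" "u \<noteq> v"
  shows "piece (p @ u @ u') \<inter> piece (p @ v @ v') = {}"
proof -
  have "piece (p @ w @ w') \<subseteq> word_comp \<phi> p ` word_comp \<phi> w ` interior X" for w w'
  proof -
    have "piece (p @ w @ w') \<subseteq> word_comp \<phi> p ` word_comp \<phi> w ` word_comp \<phi> w' ` interior X"
      using piece_subset[of "p @ w @ w'"] unfolding word_comp_append by (simp only: image_comp)
    then show ?thesis
      using word_maps_interior[of w'] by blast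
  qed
  moreover have "word_comp \<phi> p ` word_comp \<phi> u ` interior X \<inter> word_comp \<phi> p ` word_comp \<phi> v ` interior X
      = word_comp \<phi> p ` {}"
  proof -
    have "word_comp \<phi> w ` interior X \<subseteq> V" for w
      using word_maps_interior interior_subset X_subset_V by blast
    then show ?thesis
      using inj_on_image_Int[OF inj_on_word[of p]] word_images_disjoint[OF assms] by metis
  qed
  ultimately show ?thesis by blast
qed

lemma measure_piece:
  "measure lborel (piece w) = unit_ball_vol (DIM('a)) * r0 ^ DIM('a) * ratio w ^ DIM('a)"
  using content_ball[of "ratio w * r0" "word_comp \<phi> w x0"] ratio_pos[of w] r0_pos
  by (simp add: power_mult_distrib)

end

section \<open>Covering the limit set\<close>

lemma hausdorff_dim_le:
  assumes "0 < s" "hausdorff_measure s A = 0"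
  shows "hausdorff_dim A \<le> s"
  unfolding hausdorff_dim_def
  by (intro cInf_lower) (use assms in \<open>auto intro!: bdd_belowI[of _ 0]\<close>)

context cifs
begin

text \<open>The nested compact images have a common point, and it is unique because their diameters
  are at most \<open>M * \<eta> ^ n\<close>. This gives the definite description in
  \<open>proj_IFS\<close> its meaning.\<close>

lemma proj_in_word_image: "proj_IFS X \<phi> \<omega> \<in> word_comp \<phi> (map \<omega> [0..<n]) ` X"
proof -
  define S where "S n = word_comp \<phi> (map \<omega> [0..<n]) ` X" for n
  have S_Suc: "S (Suc n) \<subseteq> S n" for n
    using maps_X by (auto simp: S_def word_comp_append)
  have S_anti: "S n \<subseteq> S m" if "m \<le> n" for m n
    using that S_Suc by (rule lift_Suc_antimono_le[rotated])
  obtain M where M: "0 < M"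
    "\<And>w x y. x \<in> X \<Longrightarrow> y \<in> X \<Longrightarrow> dist (word_comp \<phi> w x) (word_comp \<phi> w y) \<le> M * ratio w"
    using word_diameter_bound by blast
  have "\<Inter> (range S) \<noteq> {}"
  proof (rule compact_nest)
    show "compact (S n)" for n
      unfolding S_def using continuous_on_subset[OF continuous_on_word X_subset_V] compact_X
      by (rule compact_continuous_image)
    show "S n \<noteq> {}" for n
      using x0_in_X by (auto simp: S_def)
  qed (rule S_anti)
  then obtain z where z: "\<And>n. z \<in> S n" by auto
  have unique: "y = z" if y: "\<And>n. 1 \<le> n \<Longrightarrow> y \<in> S n" for y
  proof -
    have "dist y z \<le> M * \<eta> ^ n" if "1 \<le> n" for n
    proof -
      have "dist y z \<le> M * ratio (map \<omega> [0..<n])"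
        using y[OF that] z[of n] M(2) by (auto simp: S_def)
      also have "\<dots> \<le> M * \<eta> ^ n"
        using ratio_le[of "map \<omega> [0..<n]"] M(1) by (simp add: mult_left_mono)
      finally show ?thesis .
    qed
    then have "eventually (\<lambda>n. dist y z \<le> M * \<eta> ^ n) sequentially"
      by (rule eventually_sequentiallyI)
    moreover have "(\<lambda>n. M * \<eta> ^ n) \<longlonglongrightarrow> M * 0"
      using \<eta>_pos \<eta>_less_1 by (intro tendsto_mult_left LIMSEQ_power_zero) auto
    ultimately have "dist y z \<le> M * 0"
      by (intro tendsto_lowerbound[of "\<lambda>n. M * \<eta> ^ n"]) auto
    then show ?thesis by simp
  qed
  have "proj_IFS X \<phi> \<omega> = z"
    unfolding proj_IFS_def by (rule the_equality) (use z unique in \<open>auto simp: S_def\<close>)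
  with z[of n] show ?thesis by (simp add: S_def)
qed

text \<open>Volume comparison: disjoint balls of radii \<open>ratio (f l) * r0\<close> inside a ball
  of radius \<open>R\<close> have total volume at most that of the large ball.\<close>

lemma sum_ratio_power_le:
  assumes "finite L" "disjoint_family_on (\<lambda>l. piece (f l)) L" "0 \<le> R"
    and "\<And>l. l \<in> L \<Longrightarrow> piece (f l) \<subseteq> cball y R"
  shows "(\<Sum>l\<in>L. ratio (f l) ^ DIM('a)) \<le> (R / r0) ^ DIM('a)"
proof -
  let ?c = "unit_ball_vol (DIM('a))"
  have c: "0 < ?c" by (simp add: unit_ball_vol_pos)
  have "?c * r0 ^ DIM('a) * (\<Sum>l\<in>L. ratio (f l) ^ DIM('a)) = (\<Sum>l\<in>L. measure lborel (piece (f l)))"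
    by (simp add: measure_piece sum_distrib_left)
  also have "\<dots> = measure lborel (\<Union>l\<in>L. piece (f l))"
  proof (rule measure_finite_Union[symmetric])
    show "emeasure lborel (piece (f l)) \<noteq> \<infinity>" for l
      using emeasure_lborel_ball_finite[of "word_comp \<phi> (f l) x0" "ratio (f l) * r0"] by simp
  qed (use assms in auto)
  also have "\<dots> \<le> measure lborel (cball y R)"
    by (rule measure_mono_fmeasurable) (use assms in \<open>auto intro!: fmeasurable_compact\<close>)
  also have "\<dots> = ?c * R ^ DIM('a)"
    using assms(3) by (simp add: content_cball)
  finally show ?thesis
    using c r0_pos by (simp add: power_divide field_simps)
qed

text \<open>Cover by the cylinders of level \<open>n\<close>. Passing from exponent \<open>t\<close>
  to \<open>t'\<close> gains the factor \<open>(\<eta> powr (t' - t)) ^ n\<close>, which tends to 0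
  while the sums for \<open>t\<close> stay bounded.\<close>

lemma hausdorff_measure_limit_set_eq_0:
  assumes t: "0 \<le> t" "t < t'"
    and B: "\<And>n F. 1 \<le> n \<Longrightarrow> finite F \<Longrightarrow> F \<subseteq> {w. length w = n} \<Longrightarrow> (\<Sum>w\<in>F. ratio w powr t) \<le> B"
  shows "hausdorff_measure t' (limit_set X \<phi>) = 0"
proof -
  obtain M where M: "0 < M"
    "\<And>w x y. x \<in> X \<Longrightarrow> y \<in> X \<Longrightarrow> dist (word_comp \<phi> w x) (word_comp \<phi> w y) \<le> M * ratio w"
    using word_diameter_bound by blast
  have "hausdorff_content t' \<delta> (limit_set X \<phi>) = 0" if \<delta>: "0 < \<delta>" for \<delta>
  proof -
    define b where "b n = M powr t' * (B * (\<eta> powr (t' - t)) ^ n)" for n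
    have le: "hausdorff_content t' \<delta> (limit_set X \<phi>) \<le> ennreal (b n)"
      if n: "1 \<le> n" and n\<delta>: "M * \<eta> ^ n \<le> \<delta>" for n
    proof -
      define W where "W = {w :: nat list. length w = n}"
      \<comment> \<open>A cover must be a sequence, so words are encoded as numbers; the other
        indices carry the empty set, which contributes 0.\<close>
      define C where "C i = (if i \<in> to_nat ` W then word_comp \<phi> (from_nat i) ` X else {})" for i
      have diam: "diameter (word_comp \<phi> w ` X) \<le> M * ratio w" for w
        using M ratio_pos[of w] by (intro diameter_le) (auto simp: dist_norm[symmetric])
      have sub: "limit_set X \<phi> \<subseteq> (\<Union>i. C i)"
      proof
        fix x assume "x \<in> limit_set X \<phi>"
        then obtain \<omega> where x: "x = proj_IFS X \<phi> \<omega>"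
          by (auto simp: limit_set_def)
        have "x \<in> C (to_nat (map \<omega> [0..<n]))"
          using proj_in_word_image[of \<omega> n] unfolding x by (simp add: C_def W_def)
        then show "x \<in> (\<Union>i. C i)" by blast
      qed
      have bd: "bounded (C i)" for i
        unfolding C_def using continuous_on_subset[OF continuous_on_word X_subset_V] compact_X
        by (auto intro!: compact_imp_bounded compact_continuous_image)
      have dC: "diameter (C i) \<le> \<delta>" for i
      proof (cases "i \<in> to_nat ` W")
        case True
        then obtain w where w: "w \<in> W" "i = to_nat w" by auto
        have "diameter (C i) \<le> M * ratio w"
          using diam[of w] w by (simp add: C_def)
        also have "\<dots> \<le> M * \<eta> ^ n"
          using ratio_le[of w] w M(1) by (simp add: W_def mult_left_mono)
        finally show ?thesis using n\<delta> by simp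
      qed (use \<delta> in \<open>simp add: C_def\<close>)
      have partial: "(\<Sum>i<m. diameter (C i) powr t') \<le> b n" for m
      proof -
        define F where "F = {w \<in> W. to_nat w < m}"
        have "finite (to_nat ` F)"
          by (rule finite_subset[of _ "{..<m}"]) (auto simp: F_def)
        then have fin: "finite F"
          by (rule finite_imageD) (meson inj_on_subset inj_to_nat top_greatest)
        have "(\<Sum>i<m. diameter (C i) powr t') = (\<Sum>i\<in>to_nat ` F. diameter (C i) powr t')"
          by (rule sum.mono_neutral_right) (auto simp: F_def C_def)
        also have "\<dots> = (\<Sum>w\<in>F. diameter (C (to_nat w)) powr t')"
          by (subst sum.reindex) (auto intro: inj_on_subset[OF inj_to_nat])
        also have "\<dots> \<le> (\<Sum>w\<in>F. M powr t' * ((\<eta> powr (t' - t)) ^ n * ratio w powr t))"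
        proof (rule sum_mono)
          fix w assume "w \<in> F"
          then have w: "w \<in> W" by (simp add: F_def)
          have "diameter (C (to_nat w)) powr t' \<le> (M * ratio w) powr t'"
            using diam[of w] w t diameter_ge_0[OF bd[of "to_nat w"]] by (intro powr_mono2) (auto simp: C_def)
          also have "\<dots> = M powr t' * (ratio w powr (t' - t) * ratio w powr t)"
            using M(1) ratio_pos[of w] by (simp add: powr_mult powr_add[symmetric])
          also have "ratio w powr (t' - t) \<le> (\<eta> ^ n) powr (t' - t)"
            using ratio_le[of w] ratio_pos[of w] w t by (intro powr_mono2) (auto simp: W_def)
          also have "(\<eta> ^ n) powr (t' - t) = (\<eta> powr (t' - t)) ^ n"
            using \<eta>_pos by (simp add: powr_realpow[symmetric] powr_powr mult.commute)
          finally show "diameter (C (to_nat w)) powr t' \<le> M powr t' * ((\<eta> powr (t' - t)) ^ n * ratio w powr t)"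
            by (simp add: mult_left_mono mult_right_mono)
        qed
        also have "\<dots> = M powr t' * ((\<eta> powr (t' - t)) ^ n * (\<Sum>w\<in>F. ratio w powr t))"
          by (simp add: sum_distrib_left)
        also have "\<dots> \<le> M powr t' * ((\<eta> powr (t' - t)) ^ n * B)"
          using B[OF n fin] by (intro mult_left_mono) (auto simp: F_def W_def)
        finally show ?thesis
          by (simp add: b_def mult.commute)
      qed
      have "hausdorff_content t' \<delta> (limit_set X \<phi>) \<le> (\<Sum>i. ennreal (diameter (C i) powr t'))"
        unfolding hausdorff_content_def by (rule INF_lower) (use sub bd dC in auto)
      also have "\<dots> \<le> ennreal (b n)"
      proof (rule suminf_le_const)
        show "(\<Sum>i<m. ennreal (diameter (C i) powr t')) \<le> ennreal (b n)" for m
          using partial[of m] by (simp add: sum_ennreal ennreal_leI)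
      qed simp
      finally show ?thesis .
    qed
    have "eventually (\<lambda>n. M * \<eta> ^ n < \<delta>) sequentially"
    proof -
      have "(\<lambda>n. M * \<eta> ^ n) \<longlonglongrightarrow> M * 0"
        using \<eta>_pos \<eta>_less_1 by (intro tendsto_mult_left LIMSEQ_power_zero) auto
      then show ?thesis
        using \<delta> by (intro order_tendstoD(2)) auto
    qed
    then have ev: "eventually (\<lambda>n. hausdorff_content t' \<delta> (limit_set X \<phi>) \<le> ennreal (b n)) sequentially"
      using eventually_ge_at_top[of 1] by eventually_elim (auto intro!: le)
    have "b \<longlonglongrightarrow> M powr t' * (B * 0)"
      unfolding b_def using \<eta>_pos \<eta>_less_1 t powr_less_mono2[of "t' - t" \<eta> 1]
      by (intro tendsto_mult_left LIMSEQ_power_zero) auto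
    then have "(\<lambda>n. ennreal (b n)) \<longlonglongrightarrow> ennreal 0"
      by (intro tendsto_ennrealI) simp
    from tendsto_lowerbound[OF this ev] show ?thesis by simp
  qed
  then show ?thesis
    unfolding hausdorff_measure_def by (simp add: SUP_constant)
qed

text \<open>Volume comparison bounds the sums for the exponent \<open>DIM('a)\<close>. The result
  provides an element of the set whose infimum is the dimension.\<close>

lemma hausdorff_measure_limit_set_Suc_DIM:
  "hausdorff_measure (DIM('a) + 1) (limit_set X \<phi>) = 0"
proof -
  obtain R where R: "\<And>x. x \<in> X \<Longrightarrow> norm x \<le> R"
    using compact_imp_bounded[OF compact_X] by (auto simp: bounded_iff)
  have R0: "0 \<le> R"
    using R[OF x0_in_X] norm_ge_zero order_trans by blast
  have "(\<Sum>w\<in>F. ratio w powr DIM('a)) \<le> (R / r0) ^ DIM('a)"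
    if F: "finite F" "F \<subseteq> {w. length w = n}" for n F
  proof -
    have "disjoint_family_on piece F"
      unfolding disjoint_family_on_def
    proof (intro ballI impI)
      fix v w assume "v \<in> F" "w \<in> F" "v \<noteq> w"
      then show "piece v \<inter> piece w = {}"
        using pieces_disjoint[of v w "[]" "[]" "[]"] F(2) by auto
    qed
    moreover have "piece w \<subseteq> cball 0 R" for w
    proof -
      have "piece w \<subseteq> X"
        using piece_subset[of w] word_maps_interior[of w] interior_subset by blast
      then show ?thesis
        using R by (meson mem_cball_0 subsetD subsetI)
    qed
    ultimately have "(\<Sum>w\<in>F. ratio w ^ DIM('a)) \<le> (R / r0) ^ DIM('a)"
      using sum_ratio_power_le[of F "\<lambda>w. w" R 0] F(1) R0 by simp
    then show ?thesis
      by (simp add: powr_realpow ratio_pos)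
  qed
  then show ?thesis
    by (intro hausdorff_measure_limit_set_eq_0[of "DIM('a)"]) auto
qed

text \<open>If all these sums stayed below 2, the covering estimate would force the dimension down
  to some \<open>t'\<close> chosen strictly between \<open>t\<close> and the dimension.\<close>

lemma exists_large_finite_word_set:
  assumes "0 < t" "t < hausdorff_dim (limit_set X \<phi>)"
  shows "\<exists>n F. 1 \<le> n \<and> finite F \<and> F \<subseteq> {w. length w = n} \<and> 2 \<le> (\<Sum>w\<in>F. ratio w powr t)"
proof (rule ccontr)
  assume neg: "\<not> ?thesis"
  obtain t' where t': "t < t'" "t' < hausdorff_dim (limit_set X \<phi>)"
    using dense assms(2) by blast
  have "hausdorff_measure t' (limit_set X \<phi>) = 0"
  proof (rule hausdorff_measure_limit_set_eq_0)
    show "(\<Sum>w\<in>F. ratio w powr t) \<le> 2"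
      if "1 \<le> n" "finite F" "F \<subseteq> {w. length w = n}" for n F
      using neg that by (meson linear)
  qed (use assms(1) t'(1) in auto)
  then have "hausdorff_dim (limit_set X \<phi>) \<le> t'"
    using assms t' by (intro hausdorff_dim_le) auto
  with t' show False by simp
qed

end

section \<open>Sequences with dense orbit\<close>

text \<open>The \<open>j\<close>-th word is placed at a position \<open>h j\<close> so late that the
  accumulated cost \<open>P j\<close> is at most \<open>2 ^ h j\<close>. All other positions hold
  the empty word, which costs nothing.\<close>

lemma sparse_insertion:
  fixes c :: "nat list \<Rightarrow> real"
  assumes c: "\<And>v. 1 \<le> c v" "c [] = 1"
  obtains u where "\<And>v. \<exists>k. u k = v" "\<And>k. (\<Prod>i<k. c (u i)) \<le> 2 ^ k"
proof -
  define v :: "nat \<Rightarrow> nat list" where "v = from_nat"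
  define P where "P j = (\<Prod>i\<le>j. c (v i))" for j
  \<comment> \<open>The summand \<open>j\<close> makes \<open>h\<close> strictly increasing, and the
    sum makes \<open>h j\<close> at least \<open>P j\<close>.\<close>
  define h where "h j = j + (\<Sum>i\<le>j. nat \<lceil>P i\<rceil>)" for j
  have h: "strict_mono h"
    by (rule strict_mono_Suc_iff[THEN iffD2]) (simp add: h_def)
  have P_h: "P j \<le> 2 ^ h j" for j
  proof -
    have "P j \<le> real (nat \<lceil>P j\<rceil>)"
      by (rule real_nat_ceiling_ge)
    also have "nat \<lceil>P j\<rceil> \<le> h j"
      using member_le_sum[of j "{..j}" "\<lambda>i. nat \<lceil>P i\<rceil>"] by (simp add: h_def)
    also have "real (h j) \<le> 2 ^ h j"
      by (metis less_imp_le of_nat_less_two_power)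
    finally show ?thesis by simp
  qed
  define u where "u k = (if k \<in> range h then v (inv h k) else [])" for k
  have inj: "inj h"
    using h by (rule strict_mono_imp_inj_on)
  have u_h: "u (h j) = v j" for j
    using inj by (simp add: u_def)
  show thesis
  proof
    show "\<exists>k. u k = w" for w
      by (metis u_h v_def from_nat_to_nat)
    show "(\<Prod>i<k. c (u i)) \<le> 2 ^ k" for k
    proof -
      define A where "A = {j. h j < k}"
      have "finite (h ` A)"
        by (rule finite_subset[of _ "{..<k}"]) (auto simp: A_def)
      then have fin: "finite A"
        using inj by (meson finite_imageD inj_on_subset top_greatest)
      have "(\<Prod>i<k. c (u i)) = (\<Prod>i\<in>h ` A. c (u i))"
        by (rule prod.mono_neutral_right) (auto simp: A_def u_def c)
      also have "\<dots> = (\<Prod>j\<in>A. c (v j))"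
        using inj by (subst prod.reindex) (auto simp: u_h intro: inj_on_subset)
      also have "\<dots> \<le> 2 ^ k"
      proof (cases "A = {}")
        case False
        have "(\<Prod>j\<in>A. c (v j)) \<le> P (Max A)"
          unfolding P_def
        proof (rule prod_mono2)
          show "0 \<le> c (v b)" for b
            using c(1)[of "v b"] by linarith
        qed (use fin c in auto)
        also have "\<dots> \<le> 2 ^ h (Max A)"
          by (rule P_h)
        also have "\<dots> \<le> 2 ^ k"
          using Max_in[OF fin False] by (intro power_increasing) (auto simp: A_def)
        finally show ?thesis .
      qed simp
      finally show ?thesis .
    qed
  qed
qed

section \<open>Alternating free words with prescribed words\<close>

definition blocks :: "(nat \<Rightarrow> nat list) \<Rightarrow> (nat \<Rightarrow> nat list) \<Rightarrow> nat \<Rightarrow> nat list" where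
  "blocks u \<omega> k = concat (map (\<lambda>i. \<omega> i @ u i) [0..<k])"

text \<open>If no \<open>\<omega> i\<close> is empty, then \<open>blocks u \<omega> (Suc j)\<close> has more than \<open>j\<close> letters.\<close>

definition block_seq :: "(nat \<Rightarrow> nat list) \<Rightarrow> (nat \<Rightarrow> nat list) \<Rightarrow> nat \<Rightarrow> nat" where
  "block_seq u \<omega> j = blocks u \<omega> (Suc j) ! j"

lemma blocks_0 [simp]: "blocks u \<omega> 0 = []"
  by (simp add: blocks_def)

lemma blocks_Suc: "blocks u \<omega> (Suc k) = blocks u \<omega> k @ \<omega> k @ u k"
  by (simp add: blocks_def)

lemma blocks_cong: "(\<And>i. i < k \<Longrightarrow> \<omega> i = \<omega>' i) \<Longrightarrow> blocks u \<omega> k = blocks u \<omega>' k"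
  unfolding blocks_def by (intro arg_cong[where f = concat] map_cong) auto

lemma blocks_prefix: "k \<le> m \<Longrightarrow> \<exists>z. blocks u \<omega> m = blocks u \<omega> k @ z"
  by (induction m rule: dec_induct) (auto simp: blocks_Suc)

lemma length_blocks_ge:
  assumes "\<And>i. \<omega> i \<noteq> []"
  shows "k \<le> length (blocks u \<omega> k)"
proof (induction k)
  case (Suc k)
  moreover have "1 \<le> length (\<omega> k)"
    using assms[of k] by (cases "\<omega> k") auto
  ultimately show ?case by (simp add: blocks_Suc)
qed simp

lemma block_seq_nth:
  assumes ne: "\<And>i. \<omega> i \<noteq> []" and j: "j < length (blocks u \<omega> k)"
  shows "block_seq u \<omega> j = blocks u \<omega> k ! j"
proof (cases "Suc j \<le> k")
  case True
  then show ?thesis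
    using blocks_prefix[OF True, of u \<omega>] length_blocks_ge[of \<omega> "Suc j" u] ne
    by (auto simp: block_seq_def nth_append Suc_le_eq)
next
  case False
  then show ?thesis
    using blocks_prefix[of k "Suc j" u \<omega>] j by (auto simp: block_seq_def nth_append)
qed

lemma map_block_seq:
  assumes "\<And>i. \<omega> i \<noteq> []"
  shows "map (block_seq u \<omega>) [0..<length (blocks u \<omega> k)] = blocks u \<omega> k"
  using block_seq_nth[OF assms] by (intro nth_equalityI) auto

lemma funpow_shift: "(shift ^^ n) \<omega> = (\<lambda>k. \<omega> (n + k))"
  by (induction n) (auto simp: shift_def)

text \<open>A basic neighbourhood of \<open>x\<close> restricts only coordinates below some
  \<open>N\<close>. The prefix of \<open>x\<close> of length \<open>N\<close> is one of the inserted
  words, and shifting to its start enters the neighbourhood.\<close>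

lemma block_seq_dense:
  assumes ne: "\<And>i. \<omega> i \<noteq> []" and u: "\<And>v. \<exists>k. u k = v"
  shows "block_seq u \<omega> \<in> dense_words"
proof -
  have "x \<in> closure {(shift ^^ n) (block_seq u \<omega>) | n. True}" for x
    unfolding closure_iff_nhds_not_empty
  proof (intro allI impI)
    fix A T assume T: "T \<subseteq> A" "open T" "x \<in> T"
    have "openin (product_topology (\<lambda>i. euclidean) UNIV) T"
      using T(2) by (simp add: open_fun_def)
    from product_topology_open_contains_basis[OF this T(3)]
    obtain Y where Y: "x \<in> Pi\<^sub>E UNIV Y" "finite {i. Y i \<noteq> UNIV}" "Pi\<^sub>E UNIV Y \<subseteq> T"
      by auto
    obtain N where "\<forall>i\<in>{i. Y i \<noteq> UNIV}. i < N"
      using Y(2) finite_nat_set_iff_bounded by blast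
    then have N: "i < N" if "Y i \<noteq> UNIV" for i
      using that by blast
    obtain k where k: "u k = map x [0..<N]"
      using u by blast
    \<comment> \<open>The offset at which the inserted word \<open>u k\<close> begins.\<close>
    define n where "n = length (blocks u \<omega> k @ \<omega> k)"
    have "block_seq u \<omega> (n + i) = x i" if "i < N" for i
    proof -
      have "block_seq u \<omega> (n + i) = blocks u \<omega> (Suc k) ! (n + i)"
        by (rule block_seq_nth[OF ne]) (use that k in \<open>simp add: n_def blocks_Suc\<close>)
      also have "blocks u \<omega> (Suc k) ! (n + i) = u k ! i"
        unfolding n_def blocks_Suc append_assoc[symmetric] nth_append_length_plus ..
      finally show ?thesis
        using that k by simp
    qed
    then have "(shift ^^ n) (block_seq u \<omega>) \<in> Pi\<^sub>E UNIV Y"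
      using Y(1) N by (auto simp: funpow_shift PiE_iff) (metis UNIV_I)
    then show "{(shift ^^ n) (block_seq u \<omega>) | n. True} \<inter> A \<noteq> {}"
      using Y(3) T(1) by blast
  qed
  then show ?thesis
    by (auto simp: dense_words_def)
qed

section \<open>Mass distribution on a Moran subset\<close>

text \<open>The exponent in \<open>u_cost\<close> collects two losses due to insertions:
  \<open>t\<close> from bounding the mass of a cylinder, and \<open>DIM('a)\<close> from bounding
  the volume of its inscribed ball below.\<close>

locale moran = cifs +
  fixes F :: "nat list set" and n :: nat and t :: real and u :: "nat \<Rightarrow> nat list"
  assumes finite_F: "finite F" and length_F: "F \<subseteq> {w. length w = n}" and n_pos: "1 \<le> n"
    and t_pos: "0 < t" and sum_F: "2 \<le> (\<Sum>w\<in>F. ratio w powr t)"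
    and u_surj: "\<And>v. \<exists>k. u k = v"
    and u_cost: "\<And>k. (\<Prod>i<k. (if u i = [] then 1 else ratio (u i)) powr - (t + DIM('a))) \<le> 2 ^ k"
begin

section \<open>The product measure on sequences of words\<close>

definition total :: real where
  "total = (\<Sum>w\<in>F. ratio w powr t)"

text \<open>An empty insertion leaves the word unchanged and must be free, whereas
  \<open>ratio []\<close> is \<open>1 / K\<close> and would cost a factor in every round.\<close>

definition cost :: "nat \<Rightarrow> real" where
  "cost i = (if u i = [] then 1 else ratio (u i))"

definition prob :: "nat list pmf" where
  "prob = embed_pmf (\<lambda>w. if w \<in> F then ratio w powr t / total else 0)"

definition \<mu> :: "(nat \<Rightarrow> nat list) measure" where
  "\<mu> = Pi\<^sub>M UNIV (\<lambda>_. measure_pmf prob)"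

text \<open>Limits the drop caused by one word of \<open>F\<close>, hence how far a stopped ratio
  can overshoot its threshold.\<close>

definition min_ratio :: real where
  "min_ratio = Min (ratio ` F)"

lemma total_ge: "2 \<le> total"
  using sum_F by (simp add: total_def)

lemma F_nonempty: "F \<noteq> {}"
  using sum_F by auto

lemma F_not_Nil: "w \<in> F \<Longrightarrow> w \<noteq> []"
  using length_F n_pos by auto

lemma cost_pos: "0 < cost i" and cost_le_1: "cost i \<le> 1"
  using ratio_pos ratio_le_1 by (auto simp: cost_def)

lemma prod_cost: "(\<Prod>i<k. cost i) powr - (t + DIM('a)) \<le> 2 ^ k"
  using u_cost[of k] cost_pos by (simp add: cost_def[symmetric] prod_powr_distrib less_imp_le)

lemma min_ratio_pos: "0 < min_ratio" and min_ratio_le: "w \<in> F \<Longrightarrow> min_ratio \<le> ratio w"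
  using finite_F F_nonempty ratio_pos by (auto simp: min_ratio_def)

lemma pmf_prob: "pmf prob w = (if w \<in> F then ratio w powr t / total else 0)"
  unfolding prob_def
proof (rule pmf_embed_pmf)
  show "0 \<le> (if w \<in> F then ratio w powr t / total else 0)" for w
    using total_ge by simp
  have "(\<integral>\<^sup>+ w. ennreal (if w \<in> F then ratio w powr t / total else 0) \<partial>count_space UNIV)
      = (\<Sum>w\<in>F. ennreal (if w \<in> F then ratio w powr t / total else 0))"
    by (rule nn_integral_count_space'[OF finite_F]) auto
  also have "\<dots> = ennreal (\<Sum>w\<in>F. ratio w powr t / total)"
    using total_ge by (simp add: sum_ennreal)
  also have "(\<Sum>w\<in>F. ratio w powr t / total) = 1"
    using total_ge by (simp add: sum_divide_distrib[symmetric] total_def[symmetric])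
  finally show "(\<integral>\<^sup>+ w. ennreal (if w \<in> F then ratio w powr t / total else 0) \<partial>count_space UNIV) = 1"
    by simp
qed

lemma set_prob: "set_pmf prob \<subseteq> F"
proof
  fix w assume "w \<in> set_pmf prob"
  then have "pmf prob w \<noteq> 0"
    by (simp add: set_pmf_iff)
  then show "w \<in> F"
    by (rule contrapos_np) (simp add: pmf_prob)
qed

sublocale product: product_prob_space "\<lambda>_. measure_pmf prob" "UNIV :: nat set"
  by (intro product_prob_spaceI) (rule measure_pmf.prob_space_axioms)

lemma prob_space_\<mu>: "prob_space \<mu>"
  unfolding \<mu>_def by (rule prob_space_PiM) (rule measure_pmf.prob_space_axioms)

lemma space_\<mu>: "space \<mu> = UNIV"
  by (simp add: \<mu>_def space_PiM)

definition cylinder :: "nat list list \<Rightarrow> (nat \<Rightarrow> nat list) set" where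
  "cylinder l = {\<omega>. \<forall>i<length l. \<omega> i = l ! i}"

lemma sets_cylinder [measurable]: "cylinder l \<in> sets \<mu>"
proof -
  have "{\<omega> \<in> space \<mu>. \<forall>i\<in>{..<length l}. \<omega> i = l ! i} \<in> sets \<mu>"
    unfolding \<mu>_def by measurable
  then show ?thesis
    by (simp add: cylinder_def space_\<mu> Ball_def)
qed

lemma emeasure_cylinder: "emeasure \<mu> (cylinder l) = ennreal (\<Prod>i<length l. pmf prob (l ! i))"
proof -
  have "emeasure \<mu> (cylinder l) = (\<Prod>i<length l. emeasure (measure_pmf prob) {l ! i})"
    using product.emeasure_PiM_Collect[of "{..<length l}" "\<lambda>i. {l ! i}"]
    by (simp add: cylinder_def \<mu>_def space_PiM Ball_def)
  also have "\<dots> = ennreal (\<Prod>i<length l. pmf prob (l ! i))"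
    by (simp add: emeasure_pmf_single prod_ennreal)
  finally show ?thesis .
qed

lemma AE_in_F: "AE \<omega> in \<mu>. \<forall>i. \<omega> i \<in> F"
  unfolding AE_all_countable
proof
  fix i
  have "AE w in measure_pmf prob. w \<in> F"
    using set_prob by (auto simp: AE_measure_pmf_iff)
  then show "AE \<omega> in \<mu>. \<omega> i \<in> F"
    unfolding \<mu>_def by (intro product.AE_component[of i "\<lambda>w. w \<in> F"]) auto
qed

lemma ratio_append_cost: "ratio w * cost i \<le> ratio (w @ u i)"
  using ratio_append[of w "u i"] by (auto simp: cost_def)

lemma ratio_blocks_Suc: "ratio (blocks u \<omega> k) * ratio (\<omega> k) * cost k \<le> ratio (blocks u \<omega> (Suc k))"
proof -
  have "ratio (blocks u \<omega> k) * ratio (\<omega> k) * cost k \<le> ratio (blocks u \<omega> k @ \<omega> k) * cost k"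
    using ratio_append[of "blocks u \<omega> k" "\<omega> k"] cost_pos[of k] by (simp add: mult_right_mono)
  also have "\<dots> \<le> ratio ((blocks u \<omega> k @ \<omega> k) @ u k)"
    by (rule ratio_append_cost)
  finally show ?thesis by (simp add: blocks_Suc)
qed

text \<open>Supermultiplicativity in each round; the single factor \<open>K\<close> compensates for
  the empty starting word.\<close>

lemma ratio_blocks_ge: "(\<Prod>i<k. ratio (\<omega> i)) * (\<Prod>i<k. cost i) \<le> K * ratio (blocks u \<omega> k)"
proof (induction k)
  case 0
  show ?case using K_ge_1 by (simp add: ratio_Nil)
next
  case (Suc k)
  have "(\<Prod>i<Suc k. ratio (\<omega> i)) * (\<Prod>i<Suc k. cost i)
      = ((\<Prod>i<k. ratio (\<omega> i)) * (\<Prod>i<k. cost i)) * (ratio (\<omega> k) * cost k)"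
    by simp
  also have "\<dots> \<le> K * ratio (blocks u \<omega> k) * (ratio (\<omega> k) * cost k)"
    using Suc ratio_pos[of "\<omega> k"] cost_pos[of k] by (intro mult_right_mono) auto
  also have "\<dots> = K * (ratio (blocks u \<omega> k) * ratio (\<omega> k) * cost k)"
    by simp
  also have "\<dots> \<le> K * ratio (blocks u \<omega> (Suc k))"
    using ratio_blocks_Suc[of \<omega> k] K_ge_1 by (intro mult_left_mono) auto
  finally show ?case .
qed

section \<open>Stopping at a given scale\<close>

abbreviation block_word :: "nat list list \<Rightarrow> nat list" where
  "block_word l \<equiv> blocks u ((!) l) (length l)"

text \<open>The first-passage words for the threshold \<open>r\<close>: no one of them is a proper
  prefix of another. Being nonempty, each has a last round, before which the ratio still exceeds
  \<open>r\<close>.\<close>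

definition stopped :: "real \<Rightarrow> nat list list set" where
  "stopped r = {l. l \<noteq> [] \<and> set l \<subseteq> F \<and> ratio (block_word l) \<le> r \<and>
    (\<forall>k<length l. r < ratio (blocks u ((!) l) k))}"

definition mass_const :: real where
  "mass_const = K powr t / min_ratio ^ DIM('a)"

text \<open>The mass is \<open>R powr t / total ^ k\<close>. Since \<open>R * Q\<close> is at most
  \<open>K * r\<close>, the numerator costs \<open>Q powr - t\<close>. Inserting the volume factor
  costs \<open>Q powr - DIM('a)\<close>. Together these losses are at most \<open>2 ^ k\<close>,
  which \<open>total ^ k\<close> absorbs.\<close>

lemma cylinder_mass_le:
  assumes r: "0 < r" and l: "l \<in> stopped r"
  shows "(\<Prod>i<length l. pmf prob (l ! i))
    \<le> mass_const * r powr t / r ^ DIM('a) * ratio (block_word l) ^ DIM('a)"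
proof -
  define k where "k = length l"
  define Q where "Q = (\<Prod>i<k. cost i)"
  define R where "R = (\<Prod>i<k. ratio (l ! i))"
  define \<rho> where "\<rho> = ratio (block_word l)"
  have lF: "l ! i \<in> F" if "i < k" for i
    using l that by (auto simp: stopped_def k_def subset_iff)
  have Q: "0 < Q"
    unfolding Q_def by (intro prod_pos) (auto simp: cost_pos)
  have R: "0 < R"
    unfolding R_def by (intro prod_pos) (auto simp: ratio_pos)
  have \<rho>: "0 < \<rho>" "\<rho> \<le> r"
    using l ratio_pos by (auto simp: \<rho>_def stopped_def)
  have "(\<Prod>i<length l. pmf prob (l ! i)) = (\<Prod>i<k. ratio (l ! i) powr t / total)"
    unfolding k_def by (intro prod.cong) (use lF in \<open>auto simp: pmf_prob k_def\<close>)
  also have "\<dots> = R powr t / total ^ k"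
    unfolding R_def by (simp add: prod_dividef prod_powr_distrib ratio_pos less_imp_le)
  finally have eq: "(\<Prod>i<length l. pmf prob (l ! i)) = R powr t / total ^ k" .
  have "R * Q \<le> K * \<rho>"
    using ratio_blocks_ge[where \<omega> = "(!) l" and k = k] by (simp add: R_def Q_def \<rho>_def k_def)
  also have "\<dots> \<le> K * r"
    using \<rho> K_ge_1 by simp
  finally have "R \<le> K * r * (1 / Q)"
    using Q by (simp add: field_simps)
  then have "R powr t \<le> (K * r * (1 / Q)) powr t"
    using R t_pos by (intro powr_mono2) auto
  also have "\<dots> = K powr t * r powr t * Q powr - t"
    using K_ge_1 r Q by (simp add: powr_mult powr_divide powr_minus_divide)
  finally have R_le: "R powr t \<le> K powr t * r powr t * Q powr - t" .
  obtain j where j: "k = Suc j"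
    using l by (cases l) (auto simp: stopped_def k_def)
  have "r * min_ratio * Q \<le> ratio (blocks u ((!) l) j) * ratio (l ! j) * cost j"
  proof (intro mult_mono)
    show "r \<le> ratio (blocks u ((!) l) j)"
      using l j by (auto simp: stopped_def k_def less_imp_le)
    show "min_ratio \<le> ratio (l ! j)"
      using lF j by (intro min_ratio_le) auto
    have "(\<Prod>i<j. cost i) \<le> 1"
      using cost_pos cost_le_1 by (intro prod_le_1) (auto intro: less_imp_le)
    then show "Q \<le> cost j"
      using mult_right_mono[of "\<Prod>i<j. cost i" 1 "cost j"] cost_pos[of j] by (simp add: Q_def j)
  qed (use r min_ratio_pos Q ratio_pos in \<open>auto intro: less_imp_le\<close>)
  also have "\<dots> \<le> \<rho>"
    using ratio_blocks_Suc[where \<omega> = "(!) l" and k = j] by (simp add: \<rho>_def j[unfolded k_def])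
  finally have "(r * min_ratio * Q) ^ DIM('a) \<le> \<rho> ^ DIM('a)"
    using r min_ratio_pos Q by (intro power_mono) auto
  \<comment> \<open>A factor of at least 1 that brings in the volume of the inscribed ball, up to
    constants.\<close>
  then have "1 \<le> \<rho> ^ DIM('a) / (r ^ DIM('a) * min_ratio ^ DIM('a)) * Q powr - DIM('a)"
    using r min_ratio_pos Q
    by (simp add: power_mult_distrib powr_minus powr_realpow field_simps)
  then have "K powr t * r powr t * Q powr - t * 1 \<le> K powr t * r powr t * Q powr - t *
      (\<rho> ^ DIM('a) / (r ^ DIM('a) * min_ratio ^ DIM('a)) * Q powr - DIM('a))"
    by (intro mult_left_mono) auto
  also have "\<dots> = mass_const * r powr t / r ^ DIM('a) * \<rho> ^ DIM('a) * Q powr - (t + DIM('a))"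
    by (simp add: mass_const_def powr_add[symmetric] field_simps)
  also have "\<dots> \<le> mass_const * r powr t / r ^ DIM('a) * \<rho> ^ DIM('a) * total ^ k"
  proof (rule mult_left_mono)
    have "Q powr - (t + DIM('a)) \<le> 2 ^ k"
      using prod_cost[of k] by (simp add: Q_def)
    also have "\<dots> \<le> total ^ k"
      using total_ge by (intro power_mono) auto
    finally show "Q powr - (t + DIM('a)) \<le> total ^ k" .
    show "0 \<le> mass_const * r powr t / r ^ DIM('a) * \<rho> ^ DIM('a)"
      using r \<rho> min_ratio_pos by (simp add: mass_const_def)
  qed
  finally have "R powr t \<le> mass_const * r powr t / r ^ DIM('a) * \<rho> ^ DIM('a) * total ^ k"
    using R_le by simp
  then show ?thesis
    unfolding eq \<rho>_def using total_ge by (simp add: divide_le_eq)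
qed

text \<open>Neither list is a proper prefix of the other, so there is a first index where they
  differ. Up to it the block words agree, and there they continue with distinct words of
  \<open>F\<close>, which have equal length.\<close>

lemma stopped_pieces_disjoint:
  assumes l: "l \<in> stopped r" and m: "m \<in> stopped r" and ne: "l \<noteq> m"
  shows "piece (block_word l) \<inter> piece (block_word m) = {}"
proof -
  have "\<exists>i<min (length l) (length m). l ! i \<noteq> m ! i"
  proof (rule ccontr)
    assume "\<not> ?thesis"
    then have same: "l ! i = m ! i" if "i < length l" "i < length m" for i
      using that by auto
    have False if "length l < length m" "l \<in> stopped r" "m \<in> stopped r"
      and "\<And>i. i < length l \<Longrightarrow> l ! i = m ! i" for l m
    proof -
      have "blocks u ((!) l) (length l) = blocks u ((!) m) (length l)"
        using that(4) by (rule blocks_cong)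
      with that show False
        by (auto simp: stopped_def)
    qed
    from this[of l m] this[of m l] have "\<not> length l < length m" "\<not> length m < length l"
      using l m same by auto
    then have "length l = length m"
      by simp
    then have "l = m"
      by (rule nth_equalityI) (use same \<open>length l = length m\<close> in auto)
    with ne show False ..
  qed
  then have ex: "\<exists>i. i < min (length l) (length m) \<and> l ! i \<noteq> m ! i"
    by blast
  define i where "i = (LEAST i. i < min (length l) (length m) \<and> l ! i \<noteq> m ! i)"
  have i: "i < length l" "i < length m" "l ! i \<noteq> m ! i"
    using LeastI_ex[OF ex] by (auto simp: i_def)
  have eq: "l ! j = m ! j" if "j < i" for j
    using not_less_Least[of j "\<lambda>i. i < min (length l) (length m) \<and> l ! i \<noteq> m ! i"] that i
    by (auto simp: i_def)
  have bl: "\<exists>z. block_word l = blocks u ((!) l) i @ l ! i @ z" if "i < length l" for l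
    using blocks_prefix[of "Suc i" "length l" u "(!) l"] that by (auto simp: blocks_Suc)
  obtain z z' where z: "block_word l = blocks u ((!) l) i @ l ! i @ z"
    "block_word m = blocks u ((!) m) i @ m ! i @ z'"
    using bl i by meson
  have "blocks u ((!) l) i = blocks u ((!) m) i"
    using eq by (rule blocks_cong)
  moreover have "l ! i \<in> F" "m ! i \<in> F"
    using l m i by (auto simp: stopped_def subset_iff)
  then have "length (l ! i) = length (m ! i)"
    using length_F by auto
  ultimately show ?thesis
    using pieces_disjoint[OF _ i(3)] unfolding z by simp
qed

lemma ratio_blocks_le:
  assumes "\<And>i. i < k \<Longrightarrow> \<omega> i \<in> F"
  shows "ratio (blocks u \<omega> k) \<le> \<eta> ^ k"
proof -
  \<comment> \<open>Entries from \<open>k\<close> on are replaced by a word of \<open>F\<close>,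
    because the length estimate asks for every entry to be nonempty.\<close>
  define \<omega>' where "\<omega>' i = (if i < k then \<omega> i else SOME w. w \<in> F)" for i
  have "\<omega>' i \<noteq> []" for i
    using assms F_not_Nil someI_ex[of "\<lambda>w. w \<in> F"] F_nonempty by (auto simp: \<omega>'_def)
  then have "k \<le> length (blocks u \<omega>' k)"
    by (rule length_blocks_ge)
  moreover have "blocks u \<omega>' k = blocks u \<omega> k"
    by (rule blocks_cong) (simp add: \<omega>'_def)
  ultimately have "\<eta> ^ length (blocks u \<omega> k) \<le> \<eta> ^ k"
    using \<eta>_pos \<eta>_less_1 by (intro power_decreasing) auto
  with ratio_le[of "blocks u \<omega> k"] show ?thesis by simp
qed

lemma finite_stopped:
  assumes "0 < r"
  shows "finite (stopped r)"
proof -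
  obtain N where N: "\<eta> ^ N < r"
    using real_arch_pow_inv[OF assms \<eta>_less_1] by auto
  have "length l \<le> N" if l: "l \<in> stopped r" for l
  proof (rule ccontr)
    assume "\<not> ?thesis"
    then have "N < length l" by simp
    then have "r < ratio (blocks u ((!) l) N)" "ratio (blocks u ((!) l) N) \<le> \<eta> ^ N"
      using l by (auto simp: stopped_def subset_iff intro!: ratio_blocks_le)
    with N show False by simp
  qed
  then have "stopped r \<subseteq> {l. set l \<subseteq> F \<and> length l \<le> N}"
    by (auto simp: stopped_def)
  then show ?thesis
    using finite_lists_length_le[OF finite_F] finite_subset by blast
qed

lemma exists_stopped:
  assumes r: "0 < r" "r < 1 / K" and \<omega>: "\<And>i. \<omega> i \<in> F"
  obtains k where "map \<omega> [0..<k] \<in> stopped r"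
proof -
  obtain N where N: "\<eta> ^ N < r"
    using real_arch_pow_inv[OF r(1) \<eta>_less_1] by auto
  have ex: "ratio (blocks u \<omega> N) \<le> r"
    using ratio_blocks_le[of N \<omega>] \<omega> N by simp
  define k where "k = (LEAST k. ratio (blocks u \<omega> k) \<le> r)"
  have k: "ratio (blocks u \<omega> k) \<le> r"
    unfolding k_def using ex by (rule LeastI)
  have k': "r < ratio (blocks u \<omega> j)" if "j < k" for j
    using not_less_Least[OF that[unfolded k_def]] by simp
  \<comment> \<open>The empty word has ratio \<open>1 / K\<close>, which is above the
    threshold.\<close>
  have "k \<noteq> 0"
  proof
    assume "k = 0"
    with k r(2) show False by (simp add: ratio_Nil)
  qed
  have eq: "blocks u ((!) (map \<omega> [0..<k])) j = blocks u \<omega> j" if "j \<le> k" for j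
    by (rule blocks_cong) (use that in simp)
  have "map \<omega> [0..<k] \<in> stopped r"
    unfolding stopped_def using \<open>k \<noteq> 0\<close> \<omega> k k' by (auto simp: eq)
  with that show thesis .
qed

text \<open>Only stopped cylinders whose images meet \<open>U\<close> matter. Their inscribed balls
  are disjoint and lie in a ball of radius comparable to \<open>r\<close>, so summing the mass
  bounds cancels \<open>r ^ DIM('a)\<close>. A measurable superset \<open>E\<close> avoids any
  measurability question about the set itself.\<close>

lemma mass_of_small_set:
  obtains C where "0 < C"
    "\<And>U r. 0 < r \<Longrightarrow> r < 1 / K \<Longrightarrow> bounded U \<Longrightarrow> diameter U \<le> r \<Longrightarrow>
      \<exists>E\<in>sets \<mu>. {\<omega>. (\<forall>i. \<omega> i \<in> F) \<and> proj_IFS X \<phi> (block_seq u \<omega>) \<in> U} \<subseteq> E \<and>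
        emeasure \<mu> E \<le> ennreal (C * r powr t)"
proof -
  obtain M where M: "0 < M"
    "\<And>w x y. x \<in> X \<Longrightarrow> y \<in> X \<Longrightarrow> dist (word_comp \<phi> w x) (word_comp \<phi> w y) \<le> M * ratio w"
    using word_diameter_bound by blast
  define C where "C = mass_const * ((1 + M) / r0) ^ DIM('a)"
  have mc: "0 < mass_const"
    using K_ge_1 min_ratio_pos by (simp add: mass_const_def)
  show thesis
  proof
    show "0 < C"
      using mc M r0_pos by (simp add: C_def)
    fix U :: "'a set" and r :: real
    assume r: "0 < r" "r < 1 / K" and U: "bounded U" "diameter U \<le> r"
    define L where "L = {l \<in> stopped r. word_comp \<phi> (block_word l) ` X \<inter> U \<noteq> {}}"
    have fin: "finite L"
      using finite_stopped[OF r(1)] by (simp add: L_def)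
    have "{\<omega>. (\<forall>i. \<omega> i \<in> F) \<and> proj_IFS X \<phi> (block_seq u \<omega>) \<in> U} \<subseteq> (\<Union>l\<in>L. cylinder l)"
    proof clarify
      fix \<omega> assume \<omega>: "\<forall>i. \<omega> i \<in> F" and in_U: "proj_IFS X \<phi> (block_seq u \<omega>) \<in> U"
      obtain k where k: "map \<omega> [0..<k] \<in> stopped r"
        using exists_stopped[OF r, of \<omega>] \<omega> by blast
      have bw: "block_word (map \<omega> [0..<k]) = blocks u \<omega> k"
        unfolding length_map length_upt diff_zero by (rule blocks_cong) simp
      have "proj_IFS X \<phi> (block_seq u \<omega>) \<in> word_comp \<phi> (blocks u \<omega> k) ` X"
        using proj_in_word_image[of "block_seq u \<omega>" "length (blocks u \<omega> k)"] \<omega> F_not_Nil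
        by (subst (asm) map_block_seq) auto
      then have "proj_IFS X \<phi> (block_seq u \<omega>) \<in> word_comp \<phi> (block_word (map \<omega> [0..<k])) ` X \<inter> U"
        unfolding bw using in_U by (rule IntI)
      then have "word_comp \<phi> (block_word (map \<omega> [0..<k])) ` X \<inter> U \<noteq> {}"
        unfolding ex_in_conv[symmetric] by (rule exI)
      with k have "map \<omega> [0..<k] \<in> L"
        unfolding L_def by simp
      moreover have "\<omega> \<in> cylinder (map \<omega> [0..<k])"
        by (simp add: cylinder_def)
      ultimately show "\<omega> \<in> (\<Union>l\<in>L. cylinder l)" by blast
    qed
    moreover have "(\<Union>l\<in>L. cylinder l) \<in> sets \<mu>"
      using fin by auto
    moreover have "emeasure \<mu> (\<Union>l\<in>L. cylinder l) \<le> ennreal (C * r powr t)"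
    proof (cases "L = {}")
      case False
      then obtain y where y: "y \<in> U"
        by (auto simp: L_def)
      \<comment> \<open>The radius adds \<open>r\<close> for the diameter of \<open>U\<close> and
        \<open>M * r\<close> for that of the cylinder image.\<close>
      have sub: "piece (block_word l) \<subseteq> cball y ((1 + M) * r)" if l: "l \<in> L" for l
      proof
        fix z assume z: "z \<in> piece (block_word l)"
        obtain x where x: "x \<in> X" "word_comp \<phi> (block_word l) x \<in> U"
          using l by (auto simp: L_def)
        obtain x' where x': "x' \<in> X" "z = word_comp \<phi> (block_word l) x'"
          using z piece_subset[of "block_word l"] interior_subset by blast
        have "dist (word_comp \<phi> (block_word l) x) z \<le> M * ratio (block_word l)"
          unfolding x'(2) by (rule M(2)[OF x(1) x'(1)])
        also have "\<dots> \<le> M * r"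
          using l M(1) by (simp add: L_def stopped_def)
        finally have 1: "dist (word_comp \<phi> (block_word l) x) z \<le> M * r" .
        have "dist y (word_comp \<phi> (block_word l) x) \<le> r"
          using diameter_bounded_bound[OF U(1) y x(2)] U(2) by simp
        with 1 dist_triangle[of y z "word_comp \<phi> (block_word l) x"]
        show "z \<in> cball y ((1 + M) * r)"
          by (simp add: algebra_simps)
      qed
      have "disjoint_family_on (\<lambda>l. piece (block_word l)) L"
        unfolding disjoint_family_on_def using stopped_pieces_disjoint by (auto simp: L_def)
      then have vol: "(\<Sum>l\<in>L. ratio (block_word l) ^ DIM('a)) \<le> ((1 + M) * r / r0) ^ DIM('a)"
        using sum_ratio_power_le[OF fin, of block_word "(1 + M) * r" y] sub M(1) r(1) by simp
      have "emeasure \<mu> (\<Union>l\<in>L. cylinder l) \<le> (\<Sum>l\<in>L. emeasure \<mu> (cylinder l))"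
        by (rule emeasure_subadditive_finite[OF fin]) auto
      also have "\<dots> = ennreal (\<Sum>l\<in>L. \<Prod>i<length l. pmf prob (l ! i))"
        by (simp add: emeasure_cylinder sum_ennreal prod_nonneg)
      also have "\<dots> \<le> ennreal (C * r powr t)"
      proof (rule ennreal_leI)
        have "(\<Sum>l\<in>L. \<Prod>i<length l. pmf prob (l ! i))
            \<le> (\<Sum>l\<in>L. mass_const * r powr t / r ^ DIM('a) * ratio (block_word l) ^ DIM('a))"
          by (intro sum_mono cylinder_mass_le[OF r(1)]) (simp add: L_def)
        also have "\<dots> = mass_const * r powr t / r ^ DIM('a) * (\<Sum>l\<in>L. ratio (block_word l) ^ DIM('a))"
          by (simp add: sum_distrib_left)
        also have "\<dots> \<le> mass_const * r powr t / r ^ DIM('a) * ((1 + M) * r / r0) ^ DIM('a)"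
          using vol mc r(1) by (intro mult_left_mono) auto
        also have "\<dots> = C * r powr t"
          using r(1) by (simp add: C_def power_mult_distrib power_divide)
        finally show "(\<Sum>l\<in>L. \<Prod>i<length l. pmf prob (l ! i)) \<le> C * r powr t" .
      qed
      finally show ?thesis .
    qed simp
    ultimately show "\<exists>E\<in>sets \<mu>. {\<omega>. (\<forall>i. \<omega> i \<in> F) \<and> proj_IFS X \<phi> (block_seq u \<omega>) \<in> U} \<subseteq> E \<and>
        emeasure \<mu> E \<le> ennreal (C * r powr t)"
      by blast
  qed
qed

text \<open>Mass distribution principle: the sets of any fine cover capture total mass 1, while each
  captures at most \<open>C\<close> times the \<open>t\<close>-th power of its diameter.\<close>

lemma hausdorff_measure_dense_pos: "hausdorff_measure t (limit_set_dense X \<phi>) \<noteq> 0"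
proof -
  obtain C where C: "0 < C"
    "\<And>U r. 0 < r \<Longrightarrow> r < 1 / K \<Longrightarrow> bounded U \<Longrightarrow> diameter U \<le> r \<Longrightarrow>
      \<exists>E\<in>sets \<mu>. {\<omega>. (\<forall>i. \<omega> i \<in> F) \<and> proj_IFS X \<phi> (block_seq u \<omega>) \<in> U} \<subseteq> E \<and>
        emeasure \<mu> E \<le> ennreal (C * r powr t)"
    using mass_of_small_set by blast
  define \<delta> where "\<delta> = 1 / (2 * K)"
  have \<delta>: "0 < \<delta>" "\<delta> < 1 / K"
    using K_ge_1 by (auto simp: \<delta>_def field_simps)
  have small: "\<exists>E\<in>sets \<mu>. {\<omega>. (\<forall>i. \<omega> i \<in> F) \<and> proj_IFS X \<phi> (block_seq u \<omega>) \<in> U} \<subseteq> E \<and>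
      emeasure \<mu> E \<le> ennreal (C * diameter U powr t)"
    if U: "bounded U" "diameter U \<le> \<delta>" for U
  proof (cases "diameter U = 0")
    case False
    then have "0 < diameter U"
      using diameter_ge_0[OF U(1)] by simp
    then show ?thesis
      using C(2)[of "diameter U" U] U \<delta> by auto
  next
    \<comment> \<open>The mass bound needs a positive radius, so it is applied at radii
      \<open>r m\<close> tending to 0. The intersection of the resulting supersets is null because
      \<open>t > 0\<close>.\<close>
    case True
    define r where "r m = \<delta> / real (Suc m)" for m
    have r: "0 < r m" "r m < 1 / K" for m
    proof -
      show "0 < r m" using \<delta> by (simp add: r_def)
      have "r m \<le> \<delta>" using \<delta> by (simp add: r_def divide_le_eq)
      with \<delta> show "r m < 1 / K" by simp
    qed
    have "\<forall>m. \<exists>E. E \<in> sets \<mu> \<and> {\<omega>. (\<forall>i. \<omega> i \<in> F) \<and> proj_IFS X \<phi> (block_seq u \<omega>) \<in> U} \<subseteq> E \<and>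
        emeasure \<mu> E \<le> ennreal (C * r m powr t)"
      using C(2)[OF r U(1)] True less_imp_le[OF r(1)] by (simp add: Bex_def)
    then obtain E where E: "\<And>m. E m \<in> sets \<mu>"
      "\<And>m. {\<omega>. (\<forall>i. \<omega> i \<in> F) \<and> proj_IFS X \<phi> (block_seq u \<omega>) \<in> U} \<subseteq> E m"
      "\<And>m. emeasure \<mu> (E m) \<le> ennreal (C * r m powr t)"
      unfolding choice_iff by blast
    have "r \<longlonglongrightarrow> 0"
      unfolding r_def by (rule lim_const_over_n[THEN LIMSEQ_Suc])
    then have "(\<lambda>m. ennreal (C * r m powr t)) \<longlonglongrightarrow> ennreal (C * 0 powr t)"
      using t_pos r by (intro tendsto_ennrealI tendsto_mult_left tendsto_powr') (auto simp: less_imp_le)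
    moreover have "emeasure \<mu> (\<Inter>m. E m) \<le> ennreal (C * r m powr t)" for m
      using E(1) by (intro order_trans[OF emeasure_mono E(3)]) auto
    ultimately have "emeasure \<mu> (\<Inter>m. E m) \<le> ennreal (C * 0 powr t)"
      by (intro tendsto_lowerbound[where f = "\<lambda>m. ennreal (C * r m powr t)"]) auto
    moreover have "(\<Inter>m. E m) \<in> sets \<mu>"
      using E(1) by auto
    ultimately show ?thesis
      using True E(2) by (intro bexI[of _ "\<Inter>m. E m"]) auto
  qed
  have "ennreal (1 / C) \<le> hausdorff_content t \<delta> (limit_set_dense X \<phi>)"
    unfolding hausdorff_content_def
  proof (rule INF_greatest)
    fix S :: "nat \<Rightarrow> 'a set"
    assume "S \<in> {S. limit_set_dense X \<phi> \<subseteq> (\<Union>i. S i) \<and> (\<forall>i. bounded (S i) \<and> diameter (S i) \<le> \<delta>)}"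
    then have S: "limit_set_dense X \<phi> \<subseteq> (\<Union>i. S i)" "\<And>i. bounded (S i)" "\<And>i. diameter (S i) \<le> \<delta>"
      by auto
    have "\<forall>j. \<exists>E. E \<in> sets \<mu> \<and> {\<omega>. (\<forall>i. \<omega> i \<in> F) \<and> proj_IFS X \<phi> (block_seq u \<omega>) \<in> S j} \<subseteq> E \<and>
        emeasure \<mu> E \<le> ennreal (C * diameter (S j) powr t)"
      using small[OF S(2,3)] by (simp add: Bex_def)
    then obtain E where E: "\<And>j. E j \<in> sets \<mu>"
      "\<And>j. {\<omega>. (\<forall>i. \<omega> i \<in> F) \<and> proj_IFS X \<phi> (block_seq u \<omega>) \<in> S j} \<subseteq> E j"
      "\<And>j. emeasure \<mu> (E j) \<le> ennreal (C * diameter (S j) powr t)"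
      unfolding choice_iff by blast
    have cover: "\<omega> \<in> (\<Union>j. E j)" if \<omega>: "\<forall>i. \<omega> i \<in> F" for \<omega>
    proof -
      have "block_seq u \<omega> \<in> dense_words"
        using \<omega> F_not_Nil u_surj by (intro block_seq_dense) auto
      then have "proj_IFS X \<phi> (block_seq u \<omega>) \<in> (\<Union>i. S i)"
        using S(1) by (auto simp: limit_set_dense_def)
      then show ?thesis
        using E(2) \<omega> by blast
    qed
    \<comment> \<open>Sequences with an entry outside \<open>F\<close> may escape the cover, but
      they form a null set.\<close>
    have "AE \<omega> in \<mu>. \<omega> \<in> space \<mu> \<longrightarrow> \<omega> \<in> (\<Union>j. E j)"
      by (rule eventually_mono[OF AE_in_F]) (intro impI cover)
    then have "emeasure \<mu> (space \<mu>) \<le> emeasure \<mu> (\<Union>j. E j)"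
      using E(1) by (intro emeasure_mono_AE) auto
    also have "\<dots> \<le> (\<Sum>j. emeasure \<mu> (E j))"
      using E(1) by (intro emeasure_subadditive_countably) auto
    also have "\<dots> \<le> (\<Sum>j. ennreal (C * diameter (S j) powr t))"
      by (intro suminf_le E) auto
    also have "\<dots> = ennreal C * (\<Sum>j. ennreal (diameter (S j) powr t))"
      using C(1) by (simp add: ennreal_mult less_imp_le)
    finally have "1 \<le> ennreal C * (\<Sum>j. ennreal (diameter (S j) powr t))"
      using prob_space.emeasure_space_1[OF prob_space_\<mu>] by simp
    then have "ennreal (1 / C) * 1 \<le> ennreal (1 / C) * (ennreal C * (\<Sum>j. ennreal (diameter (S j) powr t)))"
      by (intro mult_left_mono) auto
    also have "\<dots> = (\<Sum>j. ennreal (diameter (S j) powr t))"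
      using C(1) by (simp add: mult.assoc[symmetric] ennreal_mult[symmetric])
    finally show "ennreal (1 / C) \<le> (\<Sum>j. ennreal (diameter (S j) powr t))"
      by simp
  qed
  also have "\<dots> \<le> hausdorff_measure t (limit_set_dense X \<phi>)"
    unfolding hausdorff_measure_def using \<delta>(1) by (intro SUP_upper) simp
  finally show ?thesis
    using C(1) by auto
qed

end

section \<open>Equality of the two dimensions\<close>

context cifs
begin

lemma hausdorff_measure_limit_set_dense:
  assumes t: "0 < t" "t < hausdorff_dim (limit_set X \<phi>)"
  shows "hausdorff_measure t (limit_set_dense X \<phi>) \<noteq> 0"
proof -
  obtain n F where F: "1 \<le> n" "finite F" "F \<subseteq> {w. length w = n}" "2 \<le> (\<Sum>w\<in>F. ratio w powr t)"
    using exists_large_finite_word_set[OF t] by blast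
  \<comment> \<open>Ratios are at most 1 and the exponent is negative, so every cost is at least
    1.\<close>
  define c where "c v = (if v = [] then 1 else ratio v) powr - (t + DIM('a))" for v
  have "1 \<le> c v" for v
    using powr_mono2'[of "- (t + DIM('a))" "ratio v" 1] t ratio_pos[of v] ratio_le_1[of v]
    by (auto simp: c_def)
  moreover have "c [] = 1"
    by (simp add: c_def)
  ultimately obtain u where u: "\<And>v. \<exists>k. u k = v" "\<And>k. (\<Prod>i<k. c (u i)) \<le> 2 ^ k"
    using sparse_insertion by blast
  interpret moran X \<phi> V D K \<eta> r0 x0 F n t u
    by unfold_locales (use F u t in \<open>auto simp: c_def\<close>)
  show ?thesis
    by (rule hausdorff_measure_dense_pos)
qed

text \<open>One inequality is monotonicity. For the other, an exponent giving the dense part measure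
  0 cannot lie below the dimension of the full limit set.\<close>

lemma hausdorff_dim_limit_set_dense:
  "hausdorff_dim (limit_set_dense X \<phi>) = hausdorff_dim (limit_set X \<phi>)"
proof (rule antisym)
  have sub: "limit_set_dense X \<phi> \<subseteq> limit_set X \<phi>"
    by (auto simp: limit_set_dense_def limit_set_def)
  have content_mono: "hausdorff_content s \<delta> (limit_set_dense X \<phi>) \<le> hausdorff_content s \<delta> (limit_set X \<phi>)" for s \<delta>
    unfolding hausdorff_content_def by (rule INF_superset_mono) (use sub in auto)
  have mono: "hausdorff_measure s (limit_set_dense X \<phi>) \<le> hausdorff_measure s (limit_set X \<phi>)" for s
    unfolding hausdorff_measure_def by (rule SUP_mono') (rule content_mono)
  have zero: "hausdorff_measure s (limit_set_dense X \<phi>) = 0" if "hausdorff_measure s (limit_set X \<phi>) = 0" for s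
    using mono[of s] that by simp
  have ex: "real DIM('a) + 1 \<in> {s. s > 0 \<and> hausdorff_measure s (limit_set X \<phi>) = 0}"
    using hausdorff_measure_limit_set_Suc_DIM by (simp add: add_pos_pos add.commute)
  show "hausdorff_dim (limit_set_dense X \<phi>) \<le> hausdorff_dim (limit_set X \<phi>)"
    unfolding hausdorff_dim_def
  proof (rule cInf_superset_mono)
    show "{s. 0 < s \<and> hausdorff_measure s (limit_set X \<phi>) = 0} \<noteq> {}"
      using ex by blast
    show "{s. 0 < s \<and> hausdorff_measure s (limit_set X \<phi>) = 0}
        \<subseteq> {s. 0 < s \<and> hausdorff_measure s (limit_set_dense X \<phi>) = 0}"
      using zero by blast
  qed (auto intro!: bdd_belowI[of _ 0])
  show "hausdorff_dim (limit_set X \<phi>) \<le> hausdorff_dim (limit_set_dense X \<phi>)"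
    unfolding hausdorff_dim_def[of "limit_set_dense X \<phi>"]
  proof (rule cInf_greatest)
    show "{s. 0 < s \<and> hausdorff_measure s (limit_set_dense X \<phi>) = 0} \<noteq> {}"
      using ex zero by blast
    show "hausdorff_dim (limit_set X \<phi>) \<le> s"
      if "s \<in> {s. 0 < s \<and> hausdorff_measure s (limit_set_dense X \<phi>) = 0}" for s
      using hausdorff_measure_limit_set_dense[of s] that by (auto simp: not_le[symmetric])
  qed
qed

end

theorem theorem11p1:
  fixes X :: "'a::euclidean_space set" and \<phi> :: "nat \<Rightarrow> 'a \<Rightarrow> 'a"
  assumes "autonomous_CIFS X \<phi>"
  shows "hausdorff_dim (limit_set_dense X \<phi>) = hausdorff_dim (limit_set X \<phi>)"
proof (cases "X = {}")
  case True
  \<comment> \<open>For empty \<open>X\<close> the description in \<open>proj_IFS\<close> yields the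
    same unspecified value for all sequences. Both sets are then the same singleton, once a dense
    word is known to exist.\<close>
  obtain u :: "nat \<Rightarrow> nat list" where "\<And>v. \<exists>k. u k = v"
    using surj_from_nat by (metis surjD)
  then have "dense_words \<noteq> {}"
    using block_seq_dense[of "\<lambda>_. [0]" u] by auto
  moreover have "proj_IFS X \<phi> \<omega> = proj_IFS X \<phi> \<omega>'" for \<omega> \<omega>'
    by (simp add: proj_IFS_def True)
  ultimately have "limit_set_dense X \<phi> = limit_set X \<phi>"
    unfolding limit_set_dense_def limit_set_def by fast
  then show ?thesis by simp
next
  case False
  have "interior X \<noteq> {}"
    using assms False unfolding autonomous_CIFS_def by (metis closure_empty)
  then obtain x0 r0 where ball: "0 < r0" "ball x0 r0 \<subseteq> X"
    by (metis ex_in_conv mem_interior)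
  obtain V D K \<eta> where "compact X" "\<forall>n. \<phi> n ` X \<subseteq> X"
    "\<forall>a b. a \<noteq> b \<longrightarrow> \<phi> a ` interior X \<inter> \<phi> b ` interior X = {}"
    "open V" "connected V" "X \<subseteq> V"
    "\<forall>n. \<phi> n ` V \<subseteq> V \<and> inj_on (\<phi> n) V \<and>
      (\<forall>x\<in>V. (\<phi> n has_derivative D n x) (at x) \<and> conformal_linear (D n x)) \<and>
      (\<forall>v. continuous_on V (\<lambda>x. D n x v))"
    "1 \<le> K" "\<forall>ws x y L1 L2. x \<in> V \<longrightarrow> y \<in> V \<longrightarrow> (word_comp \<phi> ws has_derivative L1) (at x) \<longrightarrow>
      (word_comp \<phi> ws has_derivative L2) (at y) \<longrightarrow> onorm L1 \<le> K * onorm L2"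
    "\<eta> < 1" "\<forall>n. \<forall>x\<in>X. onorm (D n x) \<le> \<eta>"
    using assms unfolding autonomous_CIFS_def by (elim exE conjE) (rule that)
  with ball interpret cifs X \<phi> V D K \<eta> r0 x0
    by unfold_locales auto
  show ?thesis
    by (rule hausdorff_dim_limit_set_dense)
qed

end
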